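(* Let $(T_n)_{n\ge1}$ be a sequence of random trees, $T_n$ having vertex set $[n]$, let $p_n\in[0,1]$, and let $I_n$ be the number of fireproof vertices after the fire dynamics with parameter $p_n$ on $T_n$. Let $r:\mathbf{N}\to\mathbf{R}$ satisfy $\lim_{n\to\infty}r(n)=\infty$. For $k\ge1$, let $L_{n,k}$ be the length of the cut-tree of $T_n$ reduced to $k$ uniform random leaves, and denote by $(H_k)$ the hypothesis that $$r(n)^{-1}L_{n,k}\longrightarrow L_k\quad\text{in distribution as } n\to\infty,$$ where $L_k$ is a non-negative and finite random variable. (i) If $(H_1)$ holds and $\lim_{n\to\infty}r(n)p_n=0$, then $n^{-1}I_n$ converges in probability to $1$. (ii) If $(H_1)$ holds and $\lim_{n\to\infty}r(n)p_n=\infty$, then for every $\varepsilon>0$, $$\limsup_{n\to\infty}\mathrm{P}(I_n>\varepsilon n)\le\varepsilon^{-1}\,\mathrm{P}(L_1=0).$$ In particular, if $L_1>0$ almost surely, then $n^{-1}I_n$ converges in probability to $0$. (iii) If $(H_k)$ holds for every $k\in\mathbf{N}$ and $\lim_{n\to\infty}r(n)p_n=c$ with $c\in(0,\infty)$ fixed, then $n^{-1}I_n$ converges in distribution to a random variable $D(c)$ whose law is characterized by its entire moments: for every $k\ge1$, $$\mathrm{E}[D(c)^k]=\mathrm{E}[\exp(-cL_k)].$$ Moreover $\mathrm{P}(D(c)=0)<1$, and for every $k\ge1$, $\mathrm{P}(D(c)=1)=1$ if and only if $\mathrm{P}(L_k=0)=1$.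
   Context: Write $[n]=\{1,\dots,n\}$ and $\mathbf{N}=\{1,2,\dots\}$. Fire dynamics with parameter $p_n$ on a tree with $n$ vertices: initially every edge is flammable. The edges are considered successively in a uniform random order; an edge which has already burnt is not subject to the dynamics any more and is skipped. Otherwise, independently of everything else, the edge becomes fireproof with probability $1-p_n$ or is set on fire with probability $p_n$; in the latter case the edge burns, sets on fire its flammable neighbouring edges, and the fire propagates instantly, stopped only by fireproof edges (so that the whole connected set of flammable edges containing it burns). The dynamics continue until all edges are either burnt or fireproof. A vertex is called fireproof if all its adjacent edges are fireproof, and burnt otherwise. Cut-tree: remove the edges of $T_n$ successively in a uniform random order. At each step a subtree with vertex set $V$ splits into two subtrees with vertex sets $V'$ and $V''$. The cut-tree $\mathrm{Cut}(T_n)$ is the rooted binary tree whose nodes are the blocks (subsets of $[n]$) appearing in this fragmentation: its root is $[n]$, the two children of $V$ are $V'$ and $V''$, and its $n$ leaves are the singletons $\{1\},\dots,\{n\}$. For $k\ge1$, $R_{n,k}$ denotes $\mathrm{Cut}(T_n)$ reduced to its branches from its root to $k$ leaves chosen uniformly at random with replacement, and $L_{n,k}$ is the length (number of edges) of $R_{n,k}$. *)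

theory Defs
  imports "HOL-Probability.Probability"
begin

text \<open>A graph is a vertex set together with a set of edges, an edge being a two-element set of
  vertices.\<close>

definition adjacency :: "'a set set \<Rightarrow> ('a \<times> 'a) set" where
  "adjacency E = {(u, v). {u, v} \<in> E}"

definition is_simple_graph :: "'a set \<Rightarrow> 'a set set \<Rightarrow> bool" where
  "is_simple_graph V E \<longleftrightarrow> E \<subseteq> {{u, v} | u v. u \<in> V \<and> v \<in> V \<and> u \<noteq> v}"

definition is_connected :: "'a set \<Rightarrow> 'a set set \<Rightarrow> bool" where
  "is_connected V E \<longleftrightarrow> V \<noteq> {} \<and> (\<forall>u\<in>V. \<forall>v\<in>V. (u, v) \<in> (adjacency E)\<^sup>*)"

definition is_cycle :: "'a set set \<Rightarrow> 'a list \<Rightarrow> bool" where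
  "is_cycle E us \<longleftrightarrow> length us \<ge> 3 \<and> distinct us \<and>
     (\<forall>i<length us. {us ! i, us ! (Suc i mod length us)} \<in> E)"

definition is_tree :: "'a set \<Rightarrow> 'a set set \<Rightarrow> bool" where
  "is_tree V E \<longleftrightarrow> finite V \<and> is_simple_graph V E \<and> is_connected V E \<and> (\<nexists>us. is_cycle E us)"

definition edge_order :: "'a set set \<Rightarrow> 'a set list pmf" where
  "edge_order E = pmf_of_set (permutations_of_set E)"

text \<open>The connected set of flammable edges that contains \<open>e\<close>, when \<open>F\<close> is the set of flammable
  edges.\<close>

definition flammable_cluster :: "'a set set \<Rightarrow> 'a set \<Rightarrow> 'a set set" where
  "flammable_cluster F e = {f. (e, f) \<in> {(g, h). g \<in> F \<and> h \<in> F \<and> g \<inter> h \<noteq> {}}\<^sup>*}"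

text \<open>\<open>fire p es F P\<close> is the law of the final set of fireproof edges when the edges still to be
  considered are \<open>es\<close>, in this order, and \<open>F\<close> and \<open>P\<close> are the current sets of flammable and of
  fireproof edges; all other edges are burnt. Along the dynamics, an edge that has not been
  considered yet is either flammable or burnt, so it is skipped iff it is not in \<open>F\<close>.\<close>

primrec fire :: "real \<Rightarrow> 'a set list \<Rightarrow> 'a set set \<Rightarrow> 'a set set \<Rightarrow> 'a set set pmf" where
  "fire p [] F P = return_pmf P"
| "fire p (e # es) F P =
     (if e \<notin> F then fire p es F P
      else bernoulli_pmf p \<bind> (\<lambda>set_on_fire.
        if set_on_fire then fire p es (F - flammable_cluster F e) P
        else fire p es (F - {e}) (insert e P)))"

definition fireproof_vertices :: "'a set \<Rightarrow> 'a set set \<Rightarrow> 'a set set \<Rightarrow> 'a set" where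
  "fireproof_vertices V E P = {v \<in> V. \<forall>e\<in>E. v \<in> e \<longrightarrow> e \<in> P}"

text \<open>The law of the number of fireproof vertices for the dynamics with parameter \<open>p\<close> on a random
  tree with vertex set \<open>V\<close>, whose edge set has law \<open>T\<close>.\<close>

definition num_fireproof :: "'a set \<Rightarrow> 'a set set pmf \<Rightarrow> real \<Rightarrow> nat pmf" where
  "num_fireproof V T p =
     T \<bind> (\<lambda>E. edge_order E \<bind> (\<lambda>es. fire p es E {} \<bind>
       (\<lambda>P. return_pmf (card (fireproof_vertices V E P)))))"

definition blocks :: "'a set \<Rightarrow> 'a set set \<Rightarrow> 'a set set" where
  "blocks V E = (\<lambda>v. (adjacency E)\<^sup>* `` {v}) ` V"

text \<open>The parent-child pairs of the cut-tree when the edges are removed in the order \<open>es\<close>: removing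
  the edge \<open>es ! i\<close> splits the block \<open>B\<close> that contains it, and the children \<open>C\<close> of \<open>B\<close> are the
  two resulting subblocks.\<close>

definition cut_tree :: "'a set \<Rightarrow> 'a set set \<Rightarrow> 'a set list \<Rightarrow> ('a set \<times> 'a set) set" where
  "cut_tree V E es = {(B, C). \<exists>i<length es.
     B \<in> blocks V (E - set (take i es)) \<and> es ! i \<subseteq> B \<and>
     C \<in> blocks V (E - set (take (Suc i) es)) \<and> C \<subseteq> B}"

text \<open>The edges of the cut-tree that lie on a branch from the root \<open>V\<close> to a leaf \<open>{u}\<close> with
  \<open>u \<in> U\<close>.\<close>

definition reduced_cut_tree ::
    "'a set \<Rightarrow> 'a set set \<Rightarrow> 'a set list \<Rightarrow> 'a set \<Rightarrow> ('a set \<times> 'a set) set" where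
  "reduced_cut_tree V E es U = {(B, C) \<in> cut_tree V E es.
     (V, B) \<in> (cut_tree V E es)\<^sup>* \<and> (\<exists>u\<in>U. (C, {u}) \<in> (cut_tree V E es)\<^sup>*)}"

definition reduced_length :: "'a set \<Rightarrow> 'a set set pmf \<Rightarrow> nat \<Rightarrow> nat pmf" where
  "reduced_length V T k =
     T \<bind> (\<lambda>E. edge_order E \<bind> (\<lambda>es. replicate_pmf k (pmf_of_set V) \<bind>
       (\<lambda>us. return_pmf (card (reduced_cut_tree V E es (set us))))))"

definition conv_in_prob :: "(nat \<Rightarrow> real pmf) \<Rightarrow> real \<Rightarrow> bool" where
  "conv_in_prob X a \<longleftrightarrow>
     (\<forall>\<epsilon>>0. (\<lambda>n. measure_pmf.prob (X n) {x. \<bar>x - a\<bar> > \<epsilon>}) \<longlonglongrightarrow> 0)"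

definition conv_in_law :: "(nat \<Rightarrow> real pmf) \<Rightarrow> real measure \<Rightarrow> bool" where
  "conv_in_law X \<mu> \<longleftrightarrow> weak_conv_m (\<lambda>n. distr (measure_pmf (X n)) borel (\<lambda>x. x)) \<mu>"

text \<open>The hypothesis \<open>(H\<^sub>k)\<close>, where the limit \<open>L\<close> is a random variable on the probability
  space \<open>M\<close>.\<close>

definition cut_hypothesis ::
    "(nat \<Rightarrow> nat set set pmf) \<Rightarrow> (nat \<Rightarrow> real) \<Rightarrow> nat \<Rightarrow> 'w measure \<Rightarrow> ('w \<Rightarrow> real) \<Rightarrow> bool" where
  "cut_hypothesis T r k M L \<longleftrightarrow>
     prob_space M \<and> L \<in> borel_measurable M \<and> (AE w in M. L w \<ge> 0) \<and>
     conv_in_law (\<lambda>n. map_pmf (\<lambda>l. inverse (r n) * real l) (reduced_length {1..n} (T n) k))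
       (distr M borel L)"

definition prop_fireproof ::
    "(nat \<Rightarrow> nat set set pmf) \<Rightarrow> (nat \<Rightarrow> real) \<Rightarrow> nat \<Rightarrow> real pmf" where
  "prop_fireproof T p n =
     map_pmf (\<lambda>m. inverse (real n) * real m) (num_fireproof {1..n} (T n) (p n))"

end

theory Submission
  imports Defs
begin

text \<open>When the dynamics reaches an edge that has not burnt, its flammable cluster is the block of the
  fragmentation containing it. So if every internal node of the cut-tree is marked independently with
  probability \<open>p n\<close>, a vertex is fireproof iff the branch from the root to its leaf carries no
  mark. Hence \<open>k\<close> uniform vertices are all fireproof with conditional probability
  \<open>(1 - p n) ^ s\<close>, where \<open>s\<close> is the number of internal nodes of the reduced cut-tree; its number
  \<open>l\<close> of edges satisfies \<open>s \<le> l \<le> s + k\<close>. This sandwiches the \<open>k\<close>-th moment of the proportion of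
  fireproof vertices between Laplace transforms of \<open>l / r n\<close>, which converge under the hypothesis
  on the cut-tree. The first moment and Markov's inequality give the two extreme regimes, and the
  method of moments on \<open>[0, 1]\<close> gives the critical one.\<close>

section \<open>Averaging over compound discrete laws\<close>

lemma expectation_bind_pmf:
  fixes f :: "'a \<Rightarrow> real"
  assumes "\<And>x. \<bar>f x\<bar> \<le> B"
  shows "measure_pmf.expectation (M \<bind> N) f = (\<integral>x. measure_pmf.expectation (N x) f \<partial>measure_pmf M)"
  unfolding measure_pmf_bind
proof (rule integral_bind[where K = "count_space UNIV" and B' = 1 and B = B])
  show "measure_pmf.random_variable M (subprob_algebra (count_space UNIV)) (\<lambda>x. measure_pmf (N x))"
    by (auto simp: space_subprob_algebra prob_space_imp_subprob_space measure_pmf.prob_space_axioms)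
qed (auto simp: assms)

lemma prob_bind_pmf:
  "measure_pmf.prob (M \<bind> N) A = (\<integral>x. measure_pmf.prob (N x) A \<partial>measure_pmf M)"
  using expectation_bind_pmf[of "indicator A" 1 M N] by (simp add: indicator_def)

text \<open>Fubini for discrete laws, read off from the commutativity of independent draws: both
  sides are the probability of \<open>True\<close> under the law of the truth value of
  \<open>R x y\<close>.\<close>

lemma expectation_prob_swap:
  "(\<integral>x. measure_pmf.prob B {y. R x y} \<partial>measure_pmf A) =
   (\<integral>y. measure_pmf.prob A {x. R x y} \<partial>measure_pmf B)"
proof -
  have *: "measure_pmf.prob (B' \<bind> (\<lambda>y. return_pmf (R' y))) {True} = measure_pmf.prob B' {y. R' y}"
    for B' :: "'c pmf" and R'
    by (simp flip: map_pmf_def) (simp add: vimage_def)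
  have "(\<integral>x. measure_pmf.prob B {y. R x y} \<partial>measure_pmf A) =
      measure_pmf.prob (A \<bind> (\<lambda>x. B \<bind> (\<lambda>y. return_pmf (R x y)))) {True}"
    by (simp add: prob_bind_pmf[of A] *)
  also have "\<dots> = measure_pmf.prob (B \<bind> (\<lambda>y. A \<bind> (\<lambda>x. return_pmf (R x y)))) {True}"
    by (subst bind_commute_pmf) simp
  also have "\<dots> = (\<integral>y. measure_pmf.prob A {x. R x y} \<partial>measure_pmf B)"
    by (simp add: prob_bind_pmf[of B] *)
  finally show ?thesis .
qed

text \<open>Turns the \<open>k\<close>-th power of the proportion of fireproof vertices into the
  probability that \<open>k\<close> uniform vertices, drawn with replacement, are all
  fireproof.\<close>

lemma prob_replicate_pmf_subset:
  "measure_pmf.prob (replicate_pmf k q) {us. set us \<subseteq> A} = measure_pmf.prob q A ^ k"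
proof (induction k)
  case (Suc k)
  have "measure_pmf.prob (replicate_pmf k q \<bind> (\<lambda>xs. return_pmf (x # xs))) {us. set us \<subseteq> A} =
      indicator A x * measure_pmf.prob q A ^ k" for x
    by (cases "x \<in> A") (simp_all flip: map_pmf_def, simp_all add: vimage_def Suc.IH)
  then show ?case
    by (simp add: prob_bind_pmf[of q])
qed (simp add: indicator_def)

section \<open>Blocks, clusters and cuts\<close>

text \<open>The component of a single vertex, so that one vertex can be followed through the
  fragmentation.\<close>

definition block :: "'a set set \<Rightarrow> 'a \<Rightarrow> 'a set" where
  "block G v = (adjacency G)\<^sup>* `` {v}"

lemma sym_adjacency: "sym (adjacency G)"
  by (auto simp: sym_def adjacency_def insert_commute)

lemma block_refl [simp]: "v \<in> block G v"
  by (simp add: block_def)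

lemma block_eq: "w \<in> block G v \<Longrightarrow> block G w = block G v"
  unfolding block_def using sym_rtrancl[OF sym_adjacency[of G]]
  by (auto simp: sym_def intro: rtrancl_trans)

lemma block_mono: "G \<subseteq> H \<Longrightarrow> block G v \<subseteq> block H v"
  unfolding block_def by (intro Image_mono rtrancl_mono) (auto simp: adjacency_def)

lemma block_step: "a \<in> block G v \<Longrightarrow> {a, b} \<in> G \<Longrightarrow> b \<in> block G v"
  unfolding block_def by (auto simp: adjacency_def intro: rtrancl_into_rtrancl)

lemma block_empty [simp]: "block {} v = {v}"
  by (auto simp: block_def adjacency_def)

lemma blocks_conv_block: "blocks V G = block G ` V"
  by (simp add: blocks_def block_def)

lemma mem_blocksD: "C \<in> blocks V G \<Longrightarrow> u \<in> C \<Longrightarrow> C = block G u"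
  by (auto simp: blocks_conv_block block_eq)

text \<open>Supplies the distinctness that \<open>is_cycle\<close> demands. A vertex that would be
  repeated is handled by restarting the path at its earlier occurrence.\<close>

lemma rtrancl_imp_distinct_path:
  assumes "(a, b) \<in> r\<^sup>*"
  shows "\<exists>us. us \<noteq> [] \<and> hd us = a \<and> last us = b \<and> distinct us \<and> successively (\<lambda>x y. (x, y) \<in> r) us"
  using assms
proof (induction rule: converse_rtrancl_induct)
  case base
  show ?case by (rule exI[of _ "[b]"]) simp
next
  case (step x y)
  then obtain us where us: "us \<noteq> []" "hd us = y" "last us = b" "distinct us"
    "successively (\<lambda>x y. (x, y) \<in> r) us" by blast
  show ?case
  proof (cases "x \<in> set us")
    case True
    then obtain xs zs where "us = xs @ x # zs" by (meson split_list)
    with us show ?thesis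
      by (intro exI[of _ "x # zs"]) (auto simp: successively_append_iff)
  next
    case False
    with us step.hyps show ?thesis
      by (intro exI[of _ "x # us"]) (auto simp: successively_Cons)
  qed
qed

text \<open>A path from \<open>a\<close> to \<open>b\<close> in \<open>G\<close> would close up with
  \<open>{a, b}\<close> to a cycle of \<open>E\<close>. It has at least three vertices, because
  \<open>a \<noteq> b\<close> and \<open>{a, b}\<close> is not in \<open>G\<close>.\<close>

lemma acyclic_edge_separates:
  assumes acyc: "\<nexists>us. is_cycle E us" and e: "{a, b} \<in> E" "a \<noteq> b" and G: "G \<subseteq> E - {{a, b}}"
  shows "b \<notin> block G a"
proof
  assume "b \<in> block G a"
  then obtain us where us: "us \<noteq> []" "hd us = a" "last us = b" "distinct us"
    and succ: "successively (\<lambda>x y. (x, y) \<in> adjacency G) us"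
    using rtrancl_imp_distinct_path[of a b "adjacency G"] by (auto simp: block_def)
  have step: "{us ! i, us ! Suc i} \<in> G" if "Suc i < length us" for i
    using succ that by (auto simp: successively_conv_nth adjacency_def)
  have hd: "us ! 0 = a" and last: "us ! (length us - 1) = b"
    using us by (simp_all add: hd_conv_nth last_conv_nth)
  have "length us \<noteq> 1" using hd last e by auto
  moreover have "length us \<noteq> 2" using hd last step[of 0] G by auto
  moreover have "length us \<noteq> 0" using us(1) by simp
  ultimately have "length us \<ge> 3" by linarith
  moreover have "{us ! i, us ! (Suc i mod length us)} \<in> E" if "i < length us" for i
  proof (cases "Suc i < length us")
    case True
    then show ?thesis using step[OF True] G by auto
  next
    case False
    then have "i = length us - 1" using that by simp
    then show ?thesis using hd last e us(1) by (simp add: insert_commute)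
  qed
  ultimately have "is_cycle E us" using us by (simp add: is_cycle_def)
  with acyc show False by blast
qed

lemma flammable_cluster_subset: "e \<in> F \<Longrightarrow> flammable_cluster F e \<subseteq> F"
  unfolding flammable_cluster_def by (auto elim: rtranclE)

lemma flammable_cluster_refl [simp]: "e \<in> flammable_cluster F e"
  by (simp add: flammable_cluster_def)

lemma flammable_cluster_step:
  "f \<in> flammable_cluster F e \<Longrightarrow> f \<in> F \<Longrightarrow> h \<in> F \<Longrightarrow> f \<inter> h \<noteq> {} \<Longrightarrow> h \<in> flammable_cluster F e"
  unfolding flammable_cluster_def by (auto intro: rtrancl_into_rtrancl)

lemma flammable_cluster_induct [consumes 1, case_names base step]:
  assumes "f \<in> flammable_cluster F e"
    and "P e" and "\<And>g h. P g \<Longrightarrow> g \<in> F \<Longrightarrow> h \<in> F \<Longrightarrow> g \<inter> h \<noteq> {} \<Longrightarrow> P h"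
  shows "P f"
proof -
  have "(e, f) \<in> {(g, h). g \<in> F \<and> h \<in> F \<and> g \<inter> h \<noteq> {}}\<^sup>*"
    using assms(1) by (simp add: flammable_cluster_def)
  then show ?thesis by induction (use assms in auto)
qed

text \<open>The bridge between fragmentation, which speaks of vertices, and fire, which speaks of
  edges: a walk of vertices is a chain of edges that meet, and conversely.\<close>

lemma edge_subset_block_iff:
  assumes G: "\<And>g. g \<in> G \<Longrightarrow> \<exists>a b. g = {a, b}" and e: "e \<in> G"
  shows "e \<subseteq> block G u \<longleftrightarrow> (\<exists>f\<in>flammable_cluster G e. u \<in> f)"
proof -
  obtain a b where ab: "e = {a, b}" using G e by blast
  have b: "b \<in> block G a" using block_step[of a G a b] e ab by simp
  show ?thesis
  proof
    assume "e \<subseteq> block G u"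
    then have "u \<in> block G a" using block_eq[of a G u] ab by simp
    then have "(a, u) \<in> (adjacency G)\<^sup>*" by (simp add: block_def)
    then show "\<exists>f\<in>flammable_cluster G e. u \<in> f"
    proof induction
      case base
      then show ?case using ab flammable_cluster_refl[of e G] by blast
    next
      case (step x y)
      then obtain f where f: "f \<in> flammable_cluster G e" "x \<in> f" by blast
      moreover have "{x, y} \<in> G" using step by (simp add: adjacency_def)
      moreover have "f \<in> G" using flammable_cluster_subset[OF e] f by blast
      ultimately have "{x, y} \<in> flammable_cluster G e" using flammable_cluster_step by fast
      then show ?case by blast
    qed
  next
    assume "\<exists>f\<in>flammable_cluster G e. u \<in> f"
    then obtain f where f: "f \<in> flammable_cluster G e" "u \<in> f" by blast
    from f(1) have "f \<subseteq> block G a"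
    proof (induction rule: flammable_cluster_induct)
      case base
      show ?case using ab b by simp
    next
      case (step g h)
      then obtain x y where "h = {x, y}" using G by blast
      with step show ?case
        using block_step[of x G a y] block_step[of y G a x] by (auto simp: insert_commute)
    qed
    then have "block G u = block G a" using f(2) block_eq by fast
    then show "e \<subseteq> block G u" using ab b by simp
  qed
qed

text \<open>The vertices in \<open>U\<close> are all fireproof iff none of the edges considered at the times in \<open>cuts es U\<close>
  is set on fire.\<close>

definition cuts :: "'a set list \<Rightarrow> 'a set \<Rightarrow> nat set" where
  "cuts es U = {i. i < length es \<and> (\<exists>u\<in>U. es ! i \<subseteq> block (set (drop i es)) u)}"

lemma finite_cuts [simp]: "finite (cuts es U)"
  by (simp add: cuts_def)

lemma cuts_Nil [simp]: "cuts [] U = {}"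
  by (simp add: cuts_def)

text \<open>Mirrors the recursion of \<open>fire\<close>: time \<open>0\<close> concerns the head
  edge, and later times are those of the tail shifted by one.\<close>

lemma card_cuts_Cons:
  "card (cuts (e # es) U) =
   card (cuts es U) + (if \<exists>u\<in>U. e \<subseteq> block (set (e # es)) u then 1 else 0)"
proof -
  have "cuts (e # es) U =
      (if \<exists>u\<in>U. e \<subseteq> block (set (e # es)) u then {0} else {}) \<union> Suc ` cuts es U"
    (is "?L = ?R")
  proof (rule set_eqI)
    fix i show "i \<in> ?L \<longleftrightarrow> i \<in> ?R" by (cases i) (auto simp: cuts_def)
  qed
  then show ?thesis by (simp add: card_image)
qed

section \<open>The fire dynamics for a fixed order of the edges\<close>

lemma fire_bounds:
  "P' \<in> set_pmf (fire p es F P) \<Longrightarrow> P' \<subseteq> P \<union> F"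
proof (induction es arbitrary: F P)
  case (Cons e es)
  then show ?case by (fastforce split: if_splits)
qed simp

text \<open>The invariant of the dynamics: \<open>F\<close> is a union of clusters of the edges yet to be considered, and
  none of the edges in \<open>Q\<close>, those with an endpoint in \<open>U\<close>, has burnt.\<close>

lemma prob_fire:
  assumes "0 \<le> p" "p \<le> 1"
    and "\<And>g. g \<in> set es \<Longrightarrow> \<exists>a b. g = {a, b}" and "distinct es"
    and "F \<subseteq> set es" and "\<And>g h. g \<in> F \<Longrightarrow> h \<in> set es \<Longrightarrow> g \<inter> h \<noteq> {} \<Longrightarrow> h \<in> F"
    and "P \<inter> set es = {}"
    and "\<And>f. f \<in> set es \<Longrightarrow> f \<in> Q \<longleftrightarrow> f \<inter> U \<noteq> {}"
    and "Q \<subseteq> P \<union> F"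
  shows "measure_pmf.prob (fire p es F P) {P'. Q \<subseteq> P'} = (1 - p) ^ card (cuts es U)"
  using assms(3-)
proof (induction es arbitrary: F P)
  case Nil
  then show ?case by (auto simp: indicator_def)
next
  case (Cons e es)
  let ?G = "set (e # es)"
  let ?C = "flammable_cluster ?G e"
  note edges = Cons.prems(1) and dist = Cons.prems(2) and FG = Cons.prems(3)
    and closed = Cons.prems(4) and PG = Cons.prems(5) and QU = Cons.prems(6) and QPF = Cons.prems(7)
  have C_sub: "?C \<subseteq> ?G" by (rule flammable_cluster_subset) simp
  \<comment> \<open>Time \<open>0\<close> is a cut iff the cluster of \<open>e\<close> meets
    \<open>Q\<close>, since the remaining edges in \<open>Q\<close> are those that touch
    \<open>U\<close>.\<close>
  have "(\<exists>u\<in>U. e \<subseteq> block ?G u) \<longleftrightarrow> (\<exists>u\<in>U. \<exists>f\<in>?C. u \<in> f)"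
    using edge_subset_block_iff[of ?G e, OF edges] by simp
  also have "\<dots> \<longleftrightarrow> Q \<inter> ?C \<noteq> {}"
    using QU C_sub by blast
  finally have cut_iff: "(\<exists>u\<in>U. e \<subseteq> block ?G u) \<longleftrightarrow> Q \<inter> ?C \<noteq> {}" .
  show ?case
  proof (cases "e \<in> F")
    case False
    \<comment> \<open>As \<open>F\<close> is closed under adjacency, the whole cluster of the burnt
      edge \<open>e\<close> is burnt. It misses \<open>Q\<close>, so skipping \<open>e\<close>
      agrees with the absence of a cut at time \<open>0\<close>.\<close>
    have "f \<notin> F" if "f \<in> ?C" for f
      using that
    proof (induction rule: flammable_cluster_induct)
      case base
      show ?case by (rule False)
    next
      case (step g h)
      then show ?case using closed[of h g] by blast
    qed
    then have "Q \<inter> ?C = {}" using QPF PG C_sub by blast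
    moreover have "measure_pmf.prob (fire p es F P) {P'. Q \<subseteq> P'} = (1 - p) ^ card (cuts es U)"
    proof (rule Cons.IH)
      show "F \<subseteq> set es" using FG False by auto
      show "P \<inter> set es = {}" "Q \<subseteq> P \<union> F" "distinct es" using PG QPF dist by auto
    qed (use edges closed QU in auto)
    ultimately show ?thesis using False by (simp add: card_cuts_Cons cut_iff del: list.set)
  next
    case True
    \<comment> \<open>If \<open>e\<close> is flammable, closedness of \<open>F\<close> makes the
      cluster within \<open>F\<close> equal to the one within all remaining edges.\<close>
    have "f \<in> F \<and> f \<in> flammable_cluster F e" if "f \<in> ?C" for f
      using that
    proof (induction rule: flammable_cluster_induct)
      case base
      show ?case using True by simp
    next
      case (step g h)
      then show ?case using closed[of g h] flammable_cluster_step[of g F e h] by blast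
    qed
    moreover have "f \<in> ?C" if "f \<in> flammable_cluster F e" for f
      using that
    proof (induction rule: flammable_cluster_induct)
      case (step g h)
      then show ?case using FG flammable_cluster_step[of g ?G e h] by blast
    qed simp
    ultimately have C_eq: "flammable_cluster F e = ?C" and C_sub_F: "?C \<subseteq> F" by blast+
    have proof_case: "measure_pmf.prob (fire p es (F - {e}) (insert e P)) {P'. Q \<subseteq> P'} =
        (1 - p) ^ card (cuts es U)"
    proof (rule Cons.IH)
      show "F - {e} \<subseteq> set es" using FG by auto
      show "insert e P \<inter> set es = {}" using PG dist by auto
      show "Q \<subseteq> insert e P \<union> (F - {e})" using QPF by auto
    qed (use edges closed QU dist in auto)
    have fire_case: "measure_pmf.prob (fire p es (F - ?C) P) {P'. Q \<subseteq> P'} =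
        (if Q \<inter> ?C = {} then (1 - p) ^ card (cuts es U) else 0)"
    proof (cases "Q \<inter> ?C = {}")
      case True
      have "measure_pmf.prob (fire p es (F - ?C) P) {P'. Q \<subseteq> P'} = (1 - p) ^ card (cuts es U)"
      proof (rule Cons.IH)
        show "F - ?C \<subseteq> set es" using FG by auto
        show "P \<inter> set es = {}" using PG by auto
        show "Q \<subseteq> P \<union> (F - ?C)" using QPF True by auto
        show "h \<in> F - ?C" if "g \<in> F - ?C" "h \<in> set es" "g \<inter> h \<noteq> {}" for g h
          using that closed[of g h] flammable_cluster_step[of h ?G e g] C_sub_F FG by auto
      qed (use edges QU dist in auto)
      with True show ?thesis by simp
    next
      case False
      \<comment> \<open>The fire burns this edge of \<open>Q\<close>, and by
        \<open>fire_bounds\<close> a burnt edge never becomes fireproof.\<close>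
      then obtain f where f: "f \<in> Q" "f \<in> ?C" by blast
      then have "f \<notin> P" using C_sub PG by blast
      then have "set_pmf (fire p es (F - ?C) P) \<inter> {P'. Q \<subseteq> P'} = {}"
        using fire_bounds[of _ p es "F - ?C" P] f by blast
      then show ?thesis using False by (simp add: measure_pmf_zero_iff)
    qed
    have "measure_pmf.prob (fire p (e # es) F P) {P'. Q \<subseteq> P'} =
        measure_pmf.prob (fire p es (F - ?C) P) {P'. Q \<subseteq> P'} * p + (1 - p) ^ card (cuts es U) * (1 - p)"
      using True assms(1,2) proof_case by (simp add: prob_bind_pmf C_eq del: list.set)
    \<comment> \<open>Without a cut the two outcomes add up to \<open>p + (1 - p) = 1\<close>; with
      a cut only the factor \<open>1 - p\<close> survives.\<close>
    also have "\<dots> = (1 - p) ^ card (cuts (e # es) U)"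
      unfolding fire_case card_cuts_Cons cut_iff by (simp add: algebra_simps)
    finally show ?thesis .
  qed
qed

section \<open>The length of the reduced cut-tree\<close>

locale ordered_tree =
  fixes V :: "'a set" and E :: "'a set set" and es :: "'a set list"
  assumes tree: "is_tree V E" and order: "set es = E" "distinct es"
begin

abbreviation "level i \<equiv> set (drop i es)"

text \<open>\<open>cut_tree\<close> removes initial segments of the order, whereas
  \<open>cuts\<close> follows the recursion on suffixes; this identifies the two views.\<close>

lemma diff_take: "E - set (take i es) = level i"
proof -
  have "set (take i es) \<union> level i = E" using order by (metis append_take_drop_id set_append)
  moreover have "set (take i es) \<inter> level i = {}"
    using order(2) by (metis append_take_drop_id distinct_append)
  ultimately show ?thesis by blast
qed

lemma level_Suc: "i < length es \<Longrightarrow> level i = insert (es ! i) (level (Suc i))"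
  by (simp add: Cons_nth_drop_Suc[symmetric])

lemma level_antimono: "i \<le> j \<Longrightarrow> level j \<subseteq> level i"
  by (rule set_drop_subset_set_drop)

lemma block_antimono: "i \<le> j \<Longrightarrow> block (level j) v \<subseteq> block (level i) v"
  by (intro block_mono level_antimono)

lemma edge_doubleton: "e \<in> E \<Longrightarrow> \<exists>a b. e = {a, b} \<and> a \<noteq> b"
  using tree unfolding is_tree_def is_simple_graph_def by blast

lemma finite_V: "finite V"
  using tree by (simp add: is_tree_def)

lemma block_E: "v \<in> V \<Longrightarrow> block (level 0) v = V"
proof -
  assume v: "v \<in> V"
  have "x \<in> V" if "(v, x) \<in> (adjacency E)\<^sup>*" for x
    using that
    by induction (use tree v in \<open>auto simp: is_tree_def is_simple_graph_def adjacency_def doubleton_eq_iff\<close>)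
  then show ?thesis using tree v order by (auto simp: block_def is_tree_def is_connected_def)
qed

text \<open>In a tree the removal of an edge separates its endpoints for good.\<close>

lemma cut_splits:
  assumes i: "i < length es" "i < j" and sub: "es ! i \<subseteq> block (level j) v"
  shows False
proof -
  have e: "es ! i \<in> E" using i order by auto
  then obtain a b where ab: "es ! i = {a, b}" "a \<noteq> b" using edge_doubleton by blast
  have "es ! i \<notin> level j"
    using i order(2) by (auto simp: in_set_conv_nth nth_eq_iff_index_eq)
  moreover have "level j \<subseteq> E" using order by (auto dest: in_set_dropD)
  ultimately have "b \<notin> block (level j) a"
    using tree e ab by (intro acyclic_edge_separates[of E]) (auto simp: is_tree_def)
  moreover have "block (level j) a = block (level j) v" using sub ab block_eq by fast
  ultimately show False using sub ab by simp
qed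

text \<open>A walk from \<open>v\<close> stays in its block, hence never uses an edge that is not
  contained in this block, and so survives the removal of \<open>es ! i\<close>.\<close>

lemma block_Suc:
  assumes "i < length es" "\<not> es ! i \<subseteq> block (level i) v"
  shows "block (level (Suc i)) v = block (level i) v"
proof
  show "block (level (Suc i)) v \<subseteq> block (level i) v" by (rule block_antimono) simp
next
  have "x \<in> block (level (Suc i)) v \<and> x \<in> block (level i) v" if "(v, x) \<in> (adjacency (level i))\<^sup>*" for x
    using that
  proof induction
    case (step x y)
    have "{x, y} \<in> level i" using step by (simp add: adjacency_def)
    moreover from this have y: "y \<in> block (level i) v" using step block_step by fast
    moreover from this have "{x, y} \<noteq> es ! i" using step assms by auto
    ultimately show ?case using level_Suc[OF assms(1)] step block_step by fastforce
  qed simp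
  then show "block (level i) v \<subseteq> block (level (Suc i)) v" by (auto simp: block_def[of "level i"])
qed

lemma cut_treeI:
  assumes "i < length es" "es ! i \<subseteq> block (level i) v" "v \<in> V"
  shows "(block (level i) v, block (level (Suc i)) v) \<in> cut_tree V E es"
  unfolding cut_tree_def diff_take using assms block_antimono[of i "Suc i" v]
  by (auto simp: blocks_conv_block)

text \<open>Following the block of \<open>v\<close> through time traces the branch towards its leaf;
  times that do not split the block add no step.\<close>

lemma cut_tree_path:
  assumes "i \<le> j" "j \<le> length es" "v \<in> V"
  shows "(block (level i) v, block (level j) v) \<in> (cut_tree V E es)\<^sup>*"
  using assms(1,2)
proof (induction j rule: dec_induct)
  case (step j)
  show ?case
  proof (cases "es ! j \<subseteq> block (level j) v")
    case True
    then show ?thesis using step cut_treeI[of j v] assms(3) by (auto intro: rtrancl_into_rtrancl)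
  next
    case False
    then show ?thesis using step block_Suc[of j v] by simp
  qed
qed simp

section \<open>Counting the edges of the reduced cut-tree\<close>

lemma reduced_cut_tree_eq:
  assumes U: "U \<subseteq> V"
  shows "reduced_cut_tree V E es U =
    {(block (level i) u, block (level (Suc i)) u) | i u.
       u \<in> U \<and> i < length es \<and> es ! i \<subseteq> block (level i) u}" (is "_ = ?R")
proof
  \<comment> \<open>Children are subsets of their parents, so every node above the leaf
    \<open>{u}\<close> contains \<open>u\<close> and is the block of \<open>u\<close> at its
    level.\<close>
  have desc: "C \<supseteq> D" if "(C, D) \<in> (cut_tree V E es)\<^sup>*" for C D
    using that by induction (auto simp: cut_tree_def)
  show "reduced_cut_tree V E es U \<subseteq> ?R"
  proof
    fix x assume "x \<in> reduced_cut_tree V E es U"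
    then obtain B C u where x: "x = (B, C)" and BC: "(B, C) \<in> cut_tree V E es" and u: "u \<in> U"
      and "(C, {u}) \<in> (cut_tree V E es)\<^sup>*" by (auto simp: reduced_cut_tree_def)
    then have uC: "u \<in> C" using desc by blast
    obtain i where i: "i < length es" "es ! i \<subseteq> B" "C \<subseteq> B"
      and "B \<in> blocks V (level i)" "C \<in> blocks V (level (Suc i))"
      using BC unfolding cut_tree_def diff_take by auto
    then have "B = block (level i) u" "C = block (level (Suc i)) u"
      using mem_blocksD uC i(3) by (metis subsetD)+
    then show "x \<in> ?R" using x u i by blast
  qed
  show "?R \<subseteq> reduced_cut_tree V E es U"
  proof
    fix x assume "x \<in> ?R"
    then obtain i u where x: "x = (block (level i) u, block (level (Suc i)) u)"
      and u: "u \<in> U" and i: "i < length es" "es ! i \<subseteq> block (level i) u" by blast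
    have uV: "u \<in> V" using u U by blast
    have "(V, block (level i) u) \<in> (cut_tree V E es)\<^sup>*"
      using cut_tree_path[of 0 i u] block_E[OF uV] i uV by simp
    \<comment> \<open>After the last removal no edge is left, and the block of \<open>u\<close> is
      the leaf \<open>{u}\<close>.\<close>
    moreover have "(block (level (Suc i)) u, {u}) \<in> (cut_tree V E es)\<^sup>*"
      using cut_tree_path[of "Suc i" "length es" u] i uV by simp
    ultimately show "x \<in> reduced_cut_tree V E es U"
      using cut_treeI[OF i uV] u x by (auto simp: reduced_cut_tree_def)
  qed
qed

lemma finite_reduced_cut_tree: "U \<subseteq> V \<Longrightarrow> finite (reduced_cut_tree V E es U)"
proof -
  assume U: "U \<subseteq> V"
  have "reduced_cut_tree V E es U \<subseteq>
      (\<lambda>(i, u). (block (level i) u, block (level (Suc i)) u)) ` ({..<length es} \<times> U)"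
    unfolding reduced_cut_tree_eq[OF U] by auto
  then show ?thesis using finite_subset[OF U finite_V] finite_subset by blast
qed

text \<open>A cut time can be recovered from the parent block that it splits: it is the first time
  whose edge lies inside this block. Hence distinct cut times give distinct edges.\<close>

lemma card_cuts_le:
  assumes U: "U \<subseteq> V"
  shows "card (cuts es U) \<le> card (reduced_cut_tree V E es U)"
proof (rule surj_card_le[OF finite_reduced_cut_tree[OF U]])
  show "cuts es U \<subseteq> (\<lambda>(B, C). LEAST i. es ! i \<subseteq> B) ` reduced_cut_tree V E es U"
  proof
    fix i assume "i \<in> cuts es U"
    then obtain u where u: "u \<in> U" and i: "i < length es" "es ! i \<subseteq> block (level i) u"
      by (auto simp: cuts_def)
    have "(LEAST j. es ! j \<subseteq> block (level i) u) = i"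
    proof (rule Least_equality)
      \<comment> \<open>Only \<open>j < i\<close> needs an argument; such a \<open>j\<close> is a
        valid index and its edge has been removed, so \<open>cut_splits\<close> applies.\<close>
      show "i \<le> j" if "es ! j \<subseteq> block (level i) u" for j
        using cut_splits[of j i u] that i by (cases "i \<le> j") auto
    qed (rule i)
    moreover have "(block (level i) u, block (level (Suc i)) u) \<in> reduced_cut_tree V E es U"
      unfolding reduced_cut_tree_eq[OF U] using u i by blast
    ultimately show "i \<in> (\<lambda>(B, C). LEAST i. es ! i \<subseteq> B) ` reduced_cut_tree V E es U"
      by (force simp: image_iff)
  qed
qed

text \<open>A node has only one parent, so the edges can be counted by their lower ends. A child
  arising at two times \<open>i < j\<close> would still contain the edge \<open>es ! j\<close> after
  its removal.\<close>

lemma inj_on_snd_reduced_cut_tree: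
  assumes U: "U \<subseteq> V"
  shows "inj_on snd (reduced_cut_tree V E es U)"
proof -
  have no: False if C: "block (level (Suc i)) u = block (level (Suc j)) w" and "i < j"
    and j: "j < length es" "es ! j \<subseteq> block (level j) w" for i j u w
  proof -
    have "w \<in> block (level (Suc i)) u" using C by simp
    then have "block (level (Suc i)) w = block (level (Suc i)) u" by (rule block_eq)
    then have "es ! j \<subseteq> block (level (Suc j)) w"
      using C j(2) block_antimono[of "Suc i" j w] \<open>i < j\<close> by auto
    then show False using cut_splits[of j "Suc j" w] j(1) by simp
  qed
  have eq: "block (level i) u = block (level i) w"
    if "block (level (Suc i)) u = block (level (Suc i)) w" for i u w
  proof -
    have "w \<in> block (level (Suc i)) u" using that by simp
    then have "w \<in> block (level i) u" using block_antimono[of i "Suc i" u] by auto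
    then show ?thesis by (rule block_eq[symmetric])
  qed
  show ?thesis
  proof (rule inj_onI)
    fix x y assume x: "x \<in> reduced_cut_tree V E es U" and y: "y \<in> reduced_cut_tree V E es U"
      and xy: "snd x = snd y"
    from x obtain i u where i: "x = (block (level i) u, block (level (Suc i)) u)"
      "i < length es" "es ! i \<subseteq> block (level i) u"
      unfolding reduced_cut_tree_eq[OF U] by blast
    from y obtain j w where j: "y = (block (level j) w, block (level (Suc j)) w)"
      "j < length es" "es ! j \<subseteq> block (level j) w"
      unfolding reduced_cut_tree_eq[OF U] by blast
    have C: "block (level (Suc i)) u = block (level (Suc j)) w" using xy i j by simp
    have "i = j"
      using no[OF C _ j(2,3)] no[OF C[symmetric] _ i(2,3)] by (meson linorder_neqE_nat)
    then show "x = y" using C eq[of i u w] i(1) j(1) by simp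
  qed
qed

text \<open>A node of the reduced tree other than the root is either the leaf of some \<open>u\<close> or is split at
  a later time that determines it.\<close>

lemma card_reduced_cut_tree_le:
  assumes U: "U \<subseteq> V"
  shows "card (reduced_cut_tree V E es U) \<le> card (cuts es U) + card U"
proof -
  \<comment> \<open>Choosing an endpoint of the cut edge lets the time alone determine the block,
    whichever vertex of \<open>U\<close> it was reached from.\<close>
  let ?S = "(\<lambda>i. block (level i) (SOME x. x \<in> es ! i)) ` cuts es U"
  have fU: "finite U" using U finite_V finite_subset by blast
  \<comment> \<open>Downward induction from the last time, when blocks are singletons: either the
    current edge splits the block, or the block persists to the next time.\<close>
  have node: "block (level k) u \<in> ?S \<or> block (level k) u = {u}" if u: "u \<in> U" and k: "k \<le> length es" for k u
    using k
  proof (induction k rule: inc_induct)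
    case (step k)
    show ?case
    proof (cases "es ! k \<subseteq> block (level k) u")
      case True
      then have "k \<in> cuts es U" using u step by (auto simp: cuts_def)
      moreover obtain a where "a \<in> es ! k"
        using edge_doubleton[of "es ! k"] step.hyps order nth_mem by fastforce
      then have "(SOME x. x \<in> es ! k) \<in> es ! k" by (rule someI)
      then have "block (level k) (SOME x. x \<in> es ! k) = block (level k) u"
        using True by (intro block_eq) auto
      ultimately have "block (level k) u \<in> ?S" by (intro image_eqI[of _ _ k]) simp_all
      then show ?thesis ..
    next
      case False
      then show ?thesis using step block_Suc[of k u] by simp
    qed
  qed simp
  have "snd x \<in> ?S \<union> (\<lambda>u. {u}) ` U" if x: "x \<in> reduced_cut_tree V E es U" for x
  proof -
    obtain i u where "x = (block (level i) u, block (level (Suc i)) u)" "u \<in> U" "i < length es"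
      using x unfolding reduced_cut_tree_eq[OF U] by blast
    then show ?thesis using node[of u "Suc i"] by auto
  qed
  then have "snd ` reduced_cut_tree V E es U \<subseteq> ?S \<union> (\<lambda>u. {u}) ` U" by blast
  then have "card (snd ` reduced_cut_tree V E es U) \<le> card (?S \<union> (\<lambda>u. {u}) ` U)"
    using fU by (intro card_mono) auto
  also have "\<dots> \<le> card ?S + card ((\<lambda>u. {u}) ` U)" by (rule card_Un_le)
  also have "\<dots> \<le> card (cuts es U) + card U"
    using fU by (intro add_mono card_image_le) auto
  finally show ?thesis by (simp add: card_image inj_on_snd_reduced_cut_tree[OF U])
qed

section \<open>Moments of the proportion of fireproof vertices\<close>

lemma prob_subset_fireproof_vertices:
  assumes U: "U \<subseteq> V" and p: "0 \<le> p" "p \<le> 1"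
  shows "measure_pmf.prob (fire p es E {}) {P. U \<subseteq> fireproof_vertices V E P} = (1 - p) ^ card (cuts es U)"
proof -
  let ?Q = "{f \<in> E. f \<inter> U \<noteq> {}}"
  have "{P. U \<subseteq> fireproof_vertices V E P} = {P. ?Q \<subseteq> P}"
    using U by (auto simp: fireproof_vertices_def)
  moreover have "measure_pmf.prob (fire p es E {}) {P. ?Q \<subseteq> P} = (1 - p) ^ card (cuts es U)"
  proof (rule prob_fire[OF p])
    show "\<exists>a b. g = {a, b}" if "g \<in> set es" for g using edge_doubleton[of g] that order by blast
  qed (use order in auto)
  ultimately show ?thesis by simp
qed

text \<open>The \<open>k\<close>-th power of the proportion is the chance that \<open>k\<close>
  sampled vertices are all fireproof. Exchanging the sample with the dynamics leaves a probability
  known for each fixed sample.\<close>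

lemma moment_fireproof_vertices:
  assumes p: "0 \<le> p" "p \<le> 1" and V: "V \<noteq> {}"
  shows "(\<integral>P. (real (card (fireproof_vertices V E P)) / real (card V)) ^ k \<partial>fire p es E {}) =
    (\<integral>us. (1 - p) ^ card (cuts es (set us)) \<partial>replicate_pmf k (pmf_of_set V))"
proof -
  have sub: "V \<inter> fireproof_vertices V E P = fireproof_vertices V E P" for P
    by (auto simp: fireproof_vertices_def)
  have "(\<integral>P. (real (card (fireproof_vertices V E P)) / real (card V)) ^ k \<partial>fire p es E {}) =
      (\<integral>P. measure_pmf.prob (replicate_pmf k (pmf_of_set V)) {us. set us \<subseteq> fireproof_vertices V E P}
        \<partial>fire p es E {})"
    using V finite_V by (simp add: prob_replicate_pmf_subset measure_pmf_of_set sub)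
  also have "\<dots> = (\<integral>us. measure_pmf.prob (fire p es E {}) {P. set us \<subseteq> fireproof_vertices V E P}
        \<partial>replicate_pmf k (pmf_of_set V))"
    by (rule expectation_prob_swap)
  also have "\<dots> = (\<integral>us. (1 - p) ^ card (cuts es (set us)) \<partial>replicate_pmf k (pmf_of_set V))"
  proof (intro integral_cong_AE)
    have "set us \<subseteq> V" if "us \<in> set_pmf (replicate_pmf k (pmf_of_set V))" for us
      using that V finite_V by (auto simp: set_replicate_pmf)
    then show "AE us in replicate_pmf k (pmf_of_set V).
        measure_pmf.prob (fire p es E {}) {P. set us \<subseteq> fireproof_vertices V E P} =
        (1 - p) ^ card (cuts es (set us))"
      using prob_subset_fireproof_vertices p by (simp add: AE_measure_pmf_iff)
  qed simp_all
  finally show ?thesis .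
qed

end

text \<open>The law \<open>J\<close> couples the number \<open>s\<close> of cuts and the number
  \<open>l\<close> of edges through the same tree, order and sample. The moment is the mean of
  \<open>(1 - p) ^ s\<close>, and this power decreases in \<open>s\<close>.\<close>

lemma moment_num_fireproof_bounds:
  fixes k :: nat
  assumes trees: "\<And>E. E \<in> set_pmf T \<Longrightarrow> is_tree V E" and p: "0 \<le> p" "p \<le> 1"
  defines "m \<equiv> (\<integral>x. (real x / real (card V)) ^ k \<partial>num_fireproof V T p)"
  shows "(\<integral>l. (1 - p) ^ l \<partial>reduced_length V T k) \<le> m"
    and "m \<le> (\<integral>l. (1 - p) ^ (l - k) \<partial>reduced_length V T k)"
proof -
  define J where "J = T \<bind> (\<lambda>E. edge_order E \<bind> (\<lambda>es. replicate_pmf k (pmf_of_set V) \<bind>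
    (\<lambda>us. return_pmf (card (cuts es (set us)), card (reduced_cut_tree V E es (set us))))))"
  have len: "reduced_length V T k = map_pmf snd J"
    by (simp add: reduced_length_def J_def map_bind_pmf)
  obtain E0 where "E0 \<in> set_pmf T" using set_pmf_not_empty[of T] by blast
  then have V: "V \<noteq> {}" "finite V"
    using trees by (auto simp: is_tree_def is_connected_def)
  have ord: "ordered_tree V E es" if "E \<in> set_pmf T" "es \<in> set_pmf (edge_order E)" for E es
  proof -
    have "is_tree V E" using trees that by blast
    moreover from this have "E \<subseteq> Pow V" by (auto simp: is_tree_def is_simple_graph_def)
    then have "finite E" using V by (meson finite_Pow_iff finite_subset)
    then have "es \<in> permutations_of_set E"
      using that(2) by (simp add: edge_order_def)
    ultimately show ?thesis
      by unfold_locales (auto simp: permutations_of_set_def)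
  qed
  have bd: "\<bar>(1 - p) ^ j\<bar> \<le> 1" for j
    using p by (simp add: power_le_one)
  have J_bounds: "s \<le> l \<and> l \<le> s + k" if "(s, l) \<in> set_pmf J" for s l
  proof -
    from that obtain E es us where E: "E \<in> set_pmf T" "es \<in> set_pmf (edge_order E)"
      and us: "us \<in> set_pmf (replicate_pmf k (pmf_of_set V))"
      and sl: "s = card (cuts es (set us))" "l = card (reduced_cut_tree V E es (set us))"
      by (auto simp: J_def)
    interpret ordered_tree V E es by (rule ord[OF E])
    have "set us \<subseteq> V" "card (set us) \<le> k"
      using us V card_length[of us] by (auto simp: set_replicate_pmf)
    then show ?thesis
      using card_cuts_le[of "set us"] card_reduced_cut_tree_le[of "set us"] sl by simp
  qed
  have I: "integrable (measure_pmf J) (\<lambda>x. (1 - p) ^ f x)" for f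
    by (rule measure_pmf.integrable_const_bound[where B = 1]) (use bd in auto)
  have m: "m = (\<integral>x. (1 - p) ^ fst x \<partial>J)"
  proof -
    \<comment> \<open>The minimum bounds the integrand everywhere, as
      \<open>expectation_bind_pmf\<close> requires, and changes nothing on the support.\<close>
    define g where "g x = (real (min x (card V)) / real (card V)) ^ k" for x
    have g: "\<bar>g x\<bar> \<le> 1" for x
      unfolding g_def power_abs by (intro power_le_one) (auto simp: divide_le_eq_1)
    have card_le: "card (fireproof_vertices V E P) \<le> card V" for E P
      using V by (intro card_mono) (auto simp: fireproof_vertices_def)
    have "m = (\<integral>x. g x \<partial>num_fireproof V T p)"
      unfolding m_def g_def
      by (intro integral_cong_AE) (auto simp: AE_measure_pmf_iff num_fireproof_def min_absorb1[OF card_le])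
    also have "\<dots> = (\<integral>E. \<integral>es. \<integral>P. (real (card (fireproof_vertices V E P)) / real (card V)) ^ k
        \<partial>fire p es E {} \<partial>edge_order E \<partial>T)"
      by (simp add: num_fireproof_def expectation_bind_pmf[OF g])
         (simp add: g_def min_absorb1[OF card_le])
    also have "\<dots> = (\<integral>E. \<integral>es. \<integral>us. (1 - p) ^ card (cuts es (set us))
        \<partial>replicate_pmf k (pmf_of_set V) \<partial>edge_order E \<partial>T)"
      by (intro integral_cong_AE)
         (auto simp: AE_measure_pmf_iff V p intro!: integral_cong_AE
            ordered_tree.moment_fireproof_vertices[OF ord])
    also have "\<dots> = (\<integral>x. (1 - p) ^ fst x \<partial>J)"
      by (simp add: J_def expectation_bind_pmf[OF bd[of "fst _"]])
    finally show ?thesis .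
  qed
  show "(\<integral>l. (1 - p) ^ l \<partial>reduced_length V T k) \<le> m"
    unfolding m len integral_map_pmf
    by (intro integral_mono_AE I) (use J_bounds p in \<open>auto simp: AE_measure_pmf_iff intro!: power_decreasing\<close>)
  \<comment> \<open>Subtraction is truncated, so \<open>l - k \<le> s\<close> also holds when
    \<open>l < k\<close>.\<close>
  show "m \<le> (\<integral>l. (1 - p) ^ (l - k) \<partial>reduced_length V T k)"
    unfolding m len integral_map_pmf
    by (intro integral_mono_AE I)
       (use J_bounds p in \<open>force simp: AE_measure_pmf_iff intro!: power_decreasing\<close>)
qed

section \<open>The method of moments\<close>

text \<open>Truncating at an even order makes the error term of \<open>char_approx1\<close> a moment.\<close>

lemma (in real_distribution) char_LIMSEQ_moments:
  assumes int: "\<And>k. k \<ge> 1 \<Longrightarrow> integrable M (\<lambda>x. x ^ k)"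
    and bound: "\<And>k. k \<ge> 1 \<Longrightarrow> expectation (\<lambda>x. x ^ k) \<le> 1"
  shows "(\<lambda>n. \<Sum>k\<le>2 * n. ((\<i> * complex_of_real t) ^ k / fact k) * complex_of_real (if k = 0 then 1 else expectation (\<lambda>x. x ^ k)))
    \<longlonglongrightarrow> char M t"
proof -
  have int': "integrable M (\<lambda>x. x ^ k)" for k
    using int[of k] by (cases k) auto
  have E: "expectation (\<lambda>x. x ^ k) = (if k = 0 then 1 else expectation (\<lambda>x. x ^ k))" for k
    using prob_space by simp
  \<comment> \<open>The error bound is twice a term of the exponential series of
    \<open>\<bar>t\<bar>\<close>.\<close>
  have "(\<lambda>n. 2 * (inverse (fact (2 * n)) * \<bar>t\<bar> ^ (2 * n))) \<longlonglongrightarrow> 2 * 0"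
    by (intro tendsto_mult tendsto_const
          filterlim_compose[OF summable_LIMSEQ_zero[OF summable_exp[of "\<bar>t\<bar>"]]] mult_nat_left_at_top) simp
  then have lim: "(\<lambda>n. 2 * \<bar>t\<bar> ^ (2 * n) / fact (2 * n)) \<longlonglongrightarrow> 0"
    by (simp add: field_simps)
  let ?S = "\<lambda>n. \<Sum>k\<le>2 * n. ((\<i> * complex_of_real t) ^ k / fact k) * complex_of_real (expectation (\<lambda>x. x ^ k))"
  have "cmod (char M t - ?S n) \<le> 2 * \<bar>t\<bar> ^ (2 * n) / fact (2 * n)" for n
  proof -
    have "expectation (\<lambda>x. x ^ (2 * n)) \<le> 1"
      using bound[of "2 * n"] prob_space by (cases n) auto
    then have "2 * \<bar>t\<bar> ^ (2 * n) / fact (2 * n) * expectation (\<lambda>x. \<bar>x\<bar> ^ (2 * n))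
        \<le> 2 * \<bar>t\<bar> ^ (2 * n) / fact (2 * n) * 1"
      by (intro mult_left_mono) (simp_all add: power_even_abs)
    then show ?thesis
      using char_approx1[OF int', where n = "2 * n" and t = t] by linarith
  qed
  then have "(\<lambda>n. char M t - ?S n) \<longlonglongrightarrow> 0"
    using lim by (intro Lim_null_comparison[OF _ lim]) simp
  then have "?S \<longlonglongrightarrow> char M t"
    by (rule Lim_transform2[OF tendsto_const])
  then show ?thesis by (subst (asm) E)
qed

text \<open>Both characteristic functions are limits of the same sums. The bound on the moments
  replaces any assumption on the supports, so uniqueness holds among all distributions with these
  moments.\<close>

lemma moments_determine_distribution:
  assumes "real_distribution D" "real_distribution D'"
    and "\<And>k. k \<ge> 1 \<Longrightarrow> integrable D (\<lambda>x. x ^ k)" "\<And>k. k \<ge> 1 \<Longrightarrow> integrable D' (\<lambda>x. x ^ k)"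
    and "\<And>k. k \<ge> 1 \<Longrightarrow> (\<integral>x. x ^ k \<partial>D) = m k" "\<And>k. k \<ge> 1 \<Longrightarrow> (\<integral>x. x ^ k \<partial>D') = m k"
    and "\<And>k. k \<ge> 1 \<Longrightarrow> m k \<le> 1"
  shows "D' = D"
proof -
  interpret D: real_distribution D by fact
  interpret D': real_distribution D' by fact
  have "char D' t = char D t" for t
  proof (rule LIMSEQ_unique)
    let ?S = "\<lambda>n. \<Sum>k\<le>2 * n. ((\<i> * complex_of_real t) ^ k / fact k) * complex_of_real (if k = 0 then 1 else m k)"
    show "?S \<longlonglongrightarrow> char D t"
      using D.char_LIMSEQ_moments[of t] assms by (simp cong: sum.cong if_cong)
    show "?S \<longlonglongrightarrow> char D' t"
      using D'.char_LIMSEQ_moments[of t] assms by (simp cong: sum.cong if_cong)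
  qed
  then show ?thesis by (intro Levy_uniqueness assms(1,2)) auto
qed

lemma real_distribution_pmf: "real_distribution (distr (measure_pmf X) borel (\<lambda>x. x))"
  by (rule prob_space.real_distribution_distr) (simp_all add: measure_pmf.prob_space_axioms)

text \<open>The laws are tight, and every subsequential limit lives on \<open>[0, 1]\<close> and has
  the moments \<open>m\<close>. So all these limits coincide, and the whole sequence
  converges.\<close>

lemma conv_moments_unit_interval:
  fixes X :: "nat \<Rightarrow> real pmf"
  assumes unit: "\<And>n. set_pmf (X n) \<subseteq> {0..1}"
    and moments: "\<And>k. k \<ge> 1 \<Longrightarrow> (\<lambda>n. \<integral>x. x ^ k \<partial>X n) \<longlonglongrightarrow> m k"
  obtains D where "real_distribution D" "conv_in_law X D" "AE x in D. x \<in> {0..1}"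
    "\<And>k. k \<ge> 1 \<Longrightarrow> (\<integral>x. x ^ k \<partial>D) = m k"
proof -
  define \<mu> where "\<mu> n = distr (measure_pmf (X n)) borel (\<lambda>x. x)" for n
  have \<mu>: "real_distribution (\<mu> n)" for n
    unfolding \<mu>_def by (rule real_distribution_pmf)
  have int_\<mu>: "(\<integral>x. f x \<partial>\<mu> n) = (\<integral>x. f x \<partial>X n)" if "f \<in> borel_measurable borel" for f :: "real \<Rightarrow> real" and n
    using that by (simp add: \<mu>_def integral_distr)
  have tight: "tight \<mu>"
    unfolding tight_def
  proof (intro conjI allI impI \<mu>)
    fix \<epsilon> :: real assume "\<epsilon> > 0"
    \<comment> \<open>\<open>tight\<close> uses intervals open on the left, so the left end is below
      \<open>0\<close> to catch an atom at \<open>0\<close>.\<close>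
    have "measure (\<mu> n) {-1<..1} = 1" for n
      unfolding \<mu>_def using unit[of n]
      by (subst measure_distr) (auto simp: measure_pmf.prob_eq_1 AE_measure_pmf_iff)
    then show "\<exists>a b. a < b \<and> (\<forall>n. 1 - \<epsilon> < measure (\<mu> n) {a<..b})"
      using \<open>\<epsilon> > 0\<close> by (intro exI[of _ "-1"] exI[of _ 1]) simp
  qed
  have limit: "(AE x in \<nu>. x \<in> {0..1}) \<and> (\<forall>k\<ge>1. integrable \<nu> (\<lambda>x. x ^ k) \<and> (\<integral>x. x ^ k \<partial>\<nu>) = m k)"
    if s: "strict_mono s" and \<nu>: "real_distribution \<nu>" and conv: "weak_conv_m (\<mu> \<circ> s) \<nu>" for s \<nu>
  proof -
    interpret \<nu>: real_distribution \<nu> by fact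
    have conv_int: "(\<lambda>n. \<integral>x. f x \<partial>X (s n)) \<longlonglongrightarrow> (\<integral>x. f x \<partial>\<nu>)"
      if f: "\<And>x. isCont f x" "\<And>x. norm (f x) \<le> 1" for f :: "real \<Rightarrow> real"
    proof -
      have "f \<in> borel_measurable borel"
        using f by (intro borel_measurable_continuous_onI) (simp add: continuous_at_imp_continuous_on)
      then show ?thesis
        using weak_conv_imp_integral_bdd_continuous_conv[OF _ \<nu> conv f] \<mu> by (simp add: int_\<mu>)
    qed
    \<comment> \<open>A bounded continuous function that vanishes exactly on \<open>[0, 1]\<close>:
      its integral in the limit is \<open>0\<close>, which confines the limit law to the
      interval.\<close>
    define g :: "real \<Rightarrow> real" where "g x = min 1 (max 0 (- x) + max 0 (x - 1))" for x
    have "(\<integral>x. g x \<partial>X (s n)) = 0" for n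
      using unit[of "s n"]
      by (intro integral_eq_zero_AE) (auto simp: AE_measure_pmf_iff g_def)
    moreover have "(\<lambda>n. \<integral>x. g x \<partial>X (s n)) \<longlonglongrightarrow> (\<integral>x. g x \<partial>\<nu>)"
      by (rule conv_int) (auto simp: g_def intro!: continuous_intros)
    ultimately have "(\<integral>x. g x \<partial>\<nu>) = 0"
      by (simp add: LIMSEQ_const_iff)
    moreover have "integrable \<nu> g"
      unfolding g_def by (rule \<nu>.integrable_const_bound[where B = 1]) auto
    moreover have "AE x in \<nu>. 0 \<le> g x" by (simp add: g_def)
    ultimately have "AE x in \<nu>. g x = 0"
      by (simp add: integral_nonneg_eq_0_iff_AE)
    then have AE: "AE x in \<nu>. x \<in> {0..1}"
      by eventually_elim (auto simp: g_def min_def max_def split: if_splits)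
    have "integrable \<nu> (\<lambda>x. x ^ k) \<and> (\<integral>x. x ^ k \<partial>\<nu>) = m k" if "k \<ge> 1" for k
    proof
      show "integrable \<nu> (\<lambda>x. x ^ k)"
      proof (rule \<nu>.integrable_const_bound)
        show "AE x in \<nu>. norm (x ^ k) \<le> 1"
          using AE by eventually_elim (simp add: power_le_one)
      qed simp
      \<comment> \<open>A bounded continuous function on the line that agrees with the power on
        \<open>[0, 1]\<close>.\<close>
      define h :: "real \<Rightarrow> real" where "h x = (min 1 (max 0 x)) ^ k" for x
      have h: "h x = x ^ k" if "x \<in> {0..1}" for x
        using that by (simp add: h_def)
      have "(\<lambda>n. \<integral>x. h x \<partial>X (s n)) \<longlonglongrightarrow> (\<integral>x. h x \<partial>\<nu>)"
        by (rule conv_int) (auto simp: h_def intro!: continuous_intros power_le_one)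
      moreover have "(\<integral>x. h x \<partial>X (s n)) = (\<integral>x. x ^ k \<partial>X (s n))" for n
        using unit[of "s n"] h by (intro integral_cong_AE) (auto simp: AE_measure_pmf_iff)
      moreover have "(\<lambda>n. \<integral>x. x ^ k \<partial>X (s n)) \<longlonglongrightarrow> m k"
        using LIMSEQ_subseq_LIMSEQ[OF moments[OF that] s] by (simp add: o_def)
      ultimately have "(\<integral>x. h x \<partial>\<nu>) = m k"
        using LIMSEQ_unique by simp
      moreover have "(\<integral>x. h x \<partial>\<nu>) = (\<integral>x. x ^ k \<partial>\<nu>)"
      proof (rule integral_cong_AE)
        show "AE x in \<nu>. h x = x ^ k" using AE by eventually_elim (rule h)
      qed (simp_all add: h_def)
      ultimately show "(\<integral>x. x ^ k \<partial>\<nu>) = m k" by simp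
    qed
    with AE show ?thesis by blast
  qed
  have m_le: "m k \<le> 1" if "k \<ge> 1" for k
  proof (rule LIMSEQ_le_const2[OF moments[OF that]], intro exI allI impI)
    fix n
    have "(\<integral>x. x ^ k \<partial>X n) \<le> (\<integral>x. 1 \<partial>X n)"
      using unit[of n]
      by (intro integral_mono_AE measure_pmf.integrable_const_bound[where B = 1])
         (auto simp: AE_measure_pmf_iff subset_iff intro!: power_le_one)
    then show "(\<integral>x. x ^ k \<partial>X n) \<le> 1" by simp
  qed
  obtain s D where s: "strict_mono s" and D: "real_distribution D" and "weak_conv_m (\<mu> \<circ> id \<circ> s) D"
    using tight_imp_convergent_subsubsequence[OF tight, of id] by (auto simp: strict_mono_def)
  then have conv: "weak_conv_m (\<mu> \<circ> s) D" by simp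
  note limD = limit[OF s D conv]
  have "weak_conv_m \<mu> D"
  proof (rule tight_subseq_weak_converge[OF \<mu> D tight])
    fix s' \<nu> assume *: "strict_mono s'" "real_distribution \<nu>" "weak_conv_m (\<mu> \<circ> s') \<nu>"
    have "\<nu> = D"
      using limD limit[OF *] m_le by (intro moments_determine_distribution[OF D *(2), of m]) auto
    then show "weak_conv_m (\<mu> \<circ> s') D" using * by simp
  qed
  then have "conv_in_law X D"
    by (simp add: conv_in_law_def \<mu>_def[abs_def])
  then show thesis
    using D limD by (intro that[of D]) auto
qed

section \<open>From first moments to convergence in probability\<close>

lemma prob_gt_le_expectation:
  assumes "set_pmf X \<subseteq> {0..1}" "\<epsilon> > 0"
  shows "measure_pmf.prob X {x. x > \<epsilon>} \<le> measure_pmf.expectation X (\<lambda>x. x) / (\<epsilon>::real)"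
proof -
  have "measure_pmf.expectation X (indicator {x. x > \<epsilon>}) \<le> measure_pmf.expectation X (\<lambda>x. x / \<epsilon>)"
  proof (rule integral_mono_AE)
    show "integrable (measure_pmf X) (\<lambda>x. x / \<epsilon>)"
      using assms
      by (intro measure_pmf.integrable_const_bound[where B = "1 / \<epsilon>"])
         (auto simp: AE_measure_pmf_iff divide_right_mono subset_iff)
    show "integrable (measure_pmf X) (indicat_real {x. x > \<epsilon>})"
      by (rule measure_pmf.integrable_const_bound[where B = 1]) (auto simp: indicator_def)
  qed (use assms in \<open>auto simp: AE_measure_pmf_iff indicator_def subset_iff\<close>)
  then show ?thesis by simp
qed

lemma conv_in_prob_0I:
  assumes unit: "\<And>n. set_pmf (X n) \<subseteq> {0..1}"
    and lim: "(\<lambda>n. measure_pmf.expectation (X n) (\<lambda>x. x)) \<longlonglongrightarrow> 0"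
  shows "conv_in_prob X 0"
  unfolding conv_in_prob_def
proof (intro allI impI)
  fix \<epsilon> :: real assume \<epsilon>: "\<epsilon> > 0"
  have "measure_pmf.prob (X n) {x. \<bar>x - 0\<bar> > \<epsilon>} = measure_pmf.prob (X n) {x. x > \<epsilon>}" for n
    using unit[of n] by (intro measure_pmf.finite_measure_eq_AE) (auto simp: AE_measure_pmf_iff)
  then have le: "norm (measure_pmf.prob (X n) {x. \<bar>x - 0\<bar> > \<epsilon>}) \<le>
      measure_pmf.expectation (X n) (\<lambda>x. x) / \<epsilon>" for n
    using prob_gt_le_expectation[OF unit \<epsilon>, of n] by simp
  have "(\<lambda>n. measure_pmf.expectation (X n) (\<lambda>x. x) / \<epsilon>) \<longlonglongrightarrow> 0"
    using tendsto_divide[OF lim tendsto_const[of \<epsilon>]] \<epsilon> by simp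
  with always_eventually[rule_format, OF le]
  show "(\<lambda>n. measure_pmf.prob (X n) {x. \<bar>x - 0\<bar> > \<epsilon>}) \<longlonglongrightarrow> 0"
    by (rule Lim_null_comparison)
qed

lemma conv_in_prob_1I:
  assumes unit: "\<And>n. set_pmf (X n) \<subseteq> {0..1}"
    and lim: "(\<lambda>n. measure_pmf.expectation (X n) (\<lambda>x. x)) \<longlonglongrightarrow> 1"
  shows "conv_in_prob X 1"
proof -
  have int: "integrable (measure_pmf (X n)) (\<lambda>x. x)" for n
    using unit[of n]
    by (intro measure_pmf.integrable_const_bound[where B = 1]) (auto simp: AE_measure_pmf_iff)
  have "set_pmf (map_pmf (\<lambda>x. 1 - x) (X n)) \<subseteq> {0..1}" for n
    using unit[of n] by auto
  moreover have "(\<lambda>n. measure_pmf.expectation (map_pmf (\<lambda>x. 1 - x) (X n)) (\<lambda>x. x)) \<longlonglongrightarrow> 0"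
    using tendsto_diff[OF tendsto_const[of 1] lim] int by simp
  ultimately have "conv_in_prob (\<lambda>n. map_pmf (\<lambda>x. 1 - x) (X n)) 0"
    by (rule conv_in_prob_0I)
  then show ?thesis by (simp add: conv_in_prob_def vimage_def abs_minus_commute)
qed

section \<open>Limits of the moments\<close>

context
  fixes T :: "nat \<Rightarrow> nat set set pmf" and r :: "nat \<Rightarrow> real" and k :: nat
    and M :: "'w measure" and L :: "'w \<Rightarrow> real"
  assumes hyp: "cut_hypothesis T r k M L"
begin

interpretation prob_space M
  using hyp by (simp add: cut_hypothesis_def)

lemma L_measurable [measurable]: "L \<in> borel_measurable M"
  using hyp by (simp add: cut_hypothesis_def)

lemma L_nonneg: "AE w in M. L w \<ge> 0"
  using hyp by (simp add: cut_hypothesis_def)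

lemma laplace_AE_bounded: "a \<ge> 0 \<Longrightarrow> AE w in M. norm (exp (- a * L w)) \<le> 1"
  using L_nonneg by eventually_elim simp

lemma laplace_integrable: "a \<ge> 0 \<Longrightarrow> integrable M (\<lambda>w. exp (- a * L w))"
  by (rule integrable_const_bound[OF laplace_AE_bounded]) auto

text \<open>Finiteness of \<open>L\<close> enters here. A limit law concentrated at \<open>0\<close>
  would have first moment \<open>0\<close>, which this excludes.\<close>

lemma laplace_pos: "a \<ge> 0 \<Longrightarrow> 0 < (\<integral>w. exp (- a * L w) \<partial>M)"
proof -
  assume a: "a \<ge> 0"
  have "(\<integral>w. exp (- a * L w) \<partial>M) \<noteq> 0"
    using laplace_integrable[OF a] by (subst integral_nonneg_eq_0_iff_AE) auto
  moreover have "0 \<le> (\<integral>w. exp (- a * L w) \<partial>M)" by simp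
  ultimately show ?thesis by linarith
qed

lemma laplace_eq_1_iff:
  assumes "a > 0"
  shows "(\<integral>w. exp (- a * L w) \<partial>M) = 1 \<longleftrightarrow> measure M {w \<in> space M. L w = 0} = 1"
proof -
  have "(\<integral>w. exp (- a * L w) \<partial>M) = 1 \<longleftrightarrow> (\<integral>w. 1 - exp (- a * L w) \<partial>M) = 0"
    using laplace_integrable[of a] assms by (auto simp: prob_space)
  also have "\<dots> \<longleftrightarrow> (AE w in M. 1 - exp (- a * L w) = 0)"
    using laplace_integrable[of a] laplace_AE_bounded[of a] assms
    by (intro integral_nonneg_eq_0_iff_AE) auto
  also have "\<dots> \<longleftrightarrow> (AE w in M. L w = 0)"
    using assms by simp
  also have "\<dots> \<longleftrightarrow> measure M {w \<in> space M. L w = 0} = 1"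
    by (subst prob_Collect_eq_1) auto
  finally show ?thesis .
qed

lemma laplace_tendsto:
  assumes a: "\<And>j. a j \<ge> 0" and lim: "AE w in M. (\<lambda>j::nat. exp (- a j * L w)) \<longlonglongrightarrow> g w"
    and [measurable]: "g \<in> borel_measurable M"
  shows "(\<lambda>j. \<integral>w. exp (- a j * L w) \<partial>M) \<longlonglongrightarrow> (\<integral>w. g w \<partial>M)"
  by (rule integral_dominated_convergence[where w = "\<lambda>_. 1"]) (use lim laplace_AE_bounded[OF a] in auto)

lemma laplace_continuous:
  assumes "\<And>j. a j \<ge> 0" and "a \<longlonglongrightarrow> c"
  shows "(\<lambda>j. \<integral>w. exp (- a j * L w) \<partial>M) \<longlonglongrightarrow> (\<integral>w. exp (- c * L w) \<partial>M)"
  by (rule laplace_tendsto) (use assms in \<open>auto intro!: tendsto_intros\<close>)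

text \<open>The source of the probability that \<open>L = 0\<close> in the supercritical bound: as
  the rate grows, the exponential decreases to the indicator of this event.\<close>

lemma laplace_at_top:
  "(\<lambda>j. \<integral>w. exp (- real j * L w) \<partial>M) \<longlonglongrightarrow> measure M {w \<in> space M. L w = 0}"
proof -
  have "(\<lambda>j. \<integral>w. exp (- real j * L w) \<partial>M) \<longlonglongrightarrow> (\<integral>w. indicator {w \<in> space M. L w = 0} w \<partial>M)"
  proof (rule laplace_tendsto)
    show "AE w in M. (\<lambda>j. exp (- real j * L w)) \<longlonglongrightarrow> indicator {w \<in> space M. L w = 0} w"
      using L_nonneg AE_space
    proof eventually_elim
      case (elim w)
      show ?case
      proof (cases "L w = 0")
        case False
        have "(\<lambda>j. exp (- L w) ^ j) \<longlonglongrightarrow> 0"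
          using elim False by (intro LIMSEQ_realpow_zero) auto
        then show ?thesis using False by (simp add: exp_of_nat_mult[symmetric])
      qed (use elim in simp)
    qed
  qed auto
  then show ?thesis by simp
qed

lemma reduced_length_laplace:
  assumes r: "filterlim r at_top sequentially" and a: "a \<ge> 0"
  shows "(\<lambda>n. \<integral>l. exp (- a * (real l / r n)) \<partial>reduced_length {1..n} (T n) k)
    \<longlonglongrightarrow> (\<integral>w. exp (- a * L w) \<partial>M)"
proof -
  \<comment> \<open>The maximum makes the test function bounded on the whole line. It is harmless
    because \<open>L\<close> is almost surely nonnegative and \<open>r n\<close> is eventually
    positive.\<close>
  let ?f = "\<lambda>x. exp (- a * max 0 x)"
  let ?X = "\<lambda>n. map_pmf (\<lambda>l. inverse (r n) * real l) (reduced_length {1..n} (T n) k)"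
  have "weak_conv_m (\<lambda>n. distr (measure_pmf (?X n)) borel (\<lambda>x. x)) (distr M borel L)"
    using hyp by (simp add: cut_hypothesis_def conv_in_law_def)
  then have "(\<lambda>n. \<integral>x. ?f x \<partial>distr (measure_pmf (?X n)) borel (\<lambda>x. x)) \<longlonglongrightarrow> (\<integral>x. ?f x \<partial>distr M borel L)"
    using a
    by (intro weak_conv_imp_integral_bdd_continuous_conv[where B = 1] real_distribution_pmf
        real_distribution_distr L_measurable) (auto intro!: continuous_intros)
  moreover have "(\<integral>x. ?f x \<partial>distr M borel L) = (\<integral>w. exp (- a * L w) \<partial>M)"
    by (subst integral_distr) (use L_nonneg in \<open>auto intro!: integral_cong_AE elim!: eventually_mono simp: max_def\<close>)
  moreover have "\<forall>\<^sub>F n in sequentially. (\<integral>x. ?f x \<partial>distr (measure_pmf (?X n)) borel (\<lambda>x. x)) =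
      (\<integral>l. exp (- a * (real l / r n)) \<partial>reduced_length {1..n} (T n) k)"
    using filterlim_at_top_dense[THEN iffD1, OF r, rule_format, of 0]
    by eventually_elim (simp add: integral_distr max_def divide_inverse mult.commute)
  ultimately show ?thesis
    by (simp add: filterlim_cong)
qed

section \<open>Comparing the moments with Laplace transforms\<close>

context
  fixes p :: "nat \<Rightarrow> real"
  assumes trees: "\<And>n E. n \<ge> 1 \<Longrightarrow> E \<in> set_pmf (T n) \<Longrightarrow> is_tree {1..n} E"
    and p_range: "\<And>n. n \<ge> 1 \<Longrightarrow> 0 \<le> p n \<and> p n \<le> 1"
    and r_lim: "filterlim r at_top sequentially"
begin

abbreviation "laplace a n \<equiv> \<integral>l. exp (- a * (real l / r n)) \<partial>reduced_length {1..n} (T n) k"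

abbreviation "moment n \<equiv> \<integral>x. x ^ k \<partial>prop_fireproof T p n"

lemma moment_eq: "moment n = (\<integral>x. (real x / real (card {1..n})) ^ k \<partial>num_fireproof {1..n} (T n) (p n))"
  by (simp add: prop_fireproof_def divide_inverse mult.commute)

lemma eventually_r_pos: "\<forall>\<^sub>F n in sequentially. r n > 0"
  using r_lim by (simp add: filterlim_at_top_dense)

lemma laplace_integrable_reduced_length:
  "a \<ge> 0 \<Longrightarrow> r n > 0 \<Longrightarrow>
    integrable (reduced_length {1..n} (T n) k) (\<lambda>l. exp (- a * (real l / r n)))"
  by (rule measure_pmf.integrable_const_bound[where B = 1]) auto

text \<open>Since \<open>- ln (1 - p n) \<le> p n / (1 - p n)\<close>, the power dominates an
  exponential of rate \<open>a / r n\<close>. The room between \<open>c\<close> and \<open>a\<close>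
  absorbs the factor \<open>1 / (1 - p n)\<close> and the error in the limit.\<close>

lemma moment_lower:
  assumes c: "(\<lambda>n. r n * p n) \<longlonglongrightarrow> c" and a: "a > c" "a \<ge> 0"
  shows "\<forall>\<^sub>F n in sequentially. laplace a n \<le> moment n"
proof -
  have "(\<lambda>n. inverse (r n) * (r n * p n)) \<longlonglongrightarrow> 0 * c"
    by (intro tendsto_mult c tendsto_inverse_0_at_top r_lim)
  moreover have "\<forall>\<^sub>F n in sequentially. inverse (r n) * (r n * p n) = p n"
    using eventually_r_pos by eventually_elim simp
  ultimately have p0: "p \<longlonglongrightarrow> 0" by (simp add: filterlim_cong)
  have "(\<lambda>n. r n * p n / (1 - p n)) \<longlonglongrightarrow> c / (1 - 0)"
    by (intro tendsto_intros c p0) simp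
  then have "\<forall>\<^sub>F n in sequentially. r n * p n / (1 - p n) < a"
    using a by (intro order_tendstoD(2)) auto
  moreover have "\<forall>\<^sub>F n in sequentially. p n < 1"
    using p0 by (intro order_tendstoD(2)) auto
  ultimately show ?thesis
    using eventually_r_pos eventually_ge_at_top[of 1]
  proof eventually_elim
    case (elim n)
    have p: "0 \<le> p n" "p n \<le> 1" using p_range elim by auto
    have "ln (inverse (1 - p n)) \<le> inverse (1 - p n) - 1"
      using elim by (intro ln_le_minus_one) simp
    moreover have "inverse (1 - p n) - 1 = p n / (1 - p n)"
      using elim by (simp add: field_simps)
    ultimately have "- (p n / (1 - p n)) \<le> ln (1 - p n)"
      using elim by (simp add: ln_inverse)
    moreover have "p n / (1 - p n) \<le> a / r n"
      using elim by (simp add: field_simps)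
    ultimately have ln: "- (a / r n) \<le> ln (1 - p n)" by linarith
    have "exp (- a * (real l / r n)) \<le> (1 - p n) ^ l" for l
    proof -
      have "exp (- a * (real l / r n)) = exp (- (a / r n)) ^ l"
        by (simp add: exp_of_nat_mult[symmetric] mult.commute)
      also have "\<dots> \<le> exp (ln (1 - p n)) ^ l"
        using ln by (intro power_mono) auto
      finally show ?thesis using elim by simp
    qed
    then have "laplace a n \<le> (\<integral>l. (1 - p n) ^ l \<partial>reduced_length {1..n} (T n) k)"
      using p a elim
      by (intro integral_mono laplace_integrable_reduced_length
          measure_pmf.integrable_const_bound[where B = 1]) (auto intro!: power_le_one)
    also have "\<dots> \<le> moment n"
      unfolding moment_eq using elim trees p by (intro moment_num_fireproof_bounds) auto
    finally show ?case .
  qed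
qed

text \<open>Comparing with the rate \<open>K / r n\<close> instead of \<open>p n\<close>, which need not tend to \<open>0\<close>, makes the factor
  that accounts for the shift \<open>l - k\<close> tend to \<open>1\<close>.\<close>

lemma moment_upper:
  assumes K: "\<forall>\<^sub>F n in sequentially. K \<le> r n * p n" "K \<ge> 0"
  shows "\<forall>\<^sub>F n in sequentially. moment n \<le> exp (K * real k / r n) * laplace K n"
  using K(1) eventually_r_pos eventually_ge_at_top[of 1]
proof eventually_elim
  case (elim n)
  have p: "0 \<le> p n" "p n \<le> 1" using p_range elim by auto
  have "K / r n \<le> p n" using elim by (simp add: field_simps)
  then have 1: "1 - p n \<le> exp (- (K / r n))"
    using exp_ge_add_one_self[of "- (K / r n)"] by linarith
  have pow: "(1 - p n) ^ (l - k) \<le> exp (K * real k / r n) * exp (- K * (real l / r n))" for l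
  proof -
    have "(1 - p n) ^ (l - k) \<le> exp (- (K / r n)) ^ (l - k)"
      using 1 p by (intro power_mono) auto
    also have "\<dots> = exp (- (K / r n) * real (l - k))"
      by (simp add: exp_of_nat_mult[symmetric] mult.commute)
    \<comment> \<open>Truncated subtraction only makes the difference larger, and the coefficient is
      nonpositive.\<close>
    also have "\<dots> \<le> exp (- (K / r n) * (real l - real k))"
      using K(2) elim by (auto intro!: mult_left_mono divide_right_mono simp: of_nat_diff)
    also have "\<dots> = exp (K * real k / r n) * exp (- K * (real l / r n))"
      by (simp add: exp_add[symmetric] algebra_simps)
    finally show ?thesis .
  qed
  have "moment n \<le> (\<integral>l. (1 - p n) ^ (l - k) \<partial>reduced_length {1..n} (T n) k)"
    unfolding moment_eq using elim trees p by (intro moment_num_fireproof_bounds) auto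
  also have "\<dots> \<le> (\<integral>l. exp (K * real k / r n) * exp (- K * (real l / r n)) \<partial>reduced_length {1..n} (T n) k)"
    using p K(2) elim pow
    by (intro integral_mono integrable_mult_right laplace_integrable_reduced_length
        measure_pmf.integrable_const_bound[where B = 1]) (auto intro!: power_le_one)
  finally show ?case by simp
qed

text \<open>The lower comparison needs a rate strictly above \<open>c\<close>; continuity of the
  Laplace transform provides one that still beats \<open>u\<close>. Allowing \<open>c = 0\<close>
  covers the subcritical regime.\<close>

lemma moment_eventually_gt:
  assumes c: "(\<lambda>n. r n * p n) \<longlonglongrightarrow> c" "c \<ge> 0" and u: "u < (\<integral>w. exp (- c * L w) \<partial>M)"
  shows "\<forall>\<^sub>F n in sequentially. u < moment n"
proof -
  have "(\<lambda>j. c + inverse (real (Suc j))) \<longlonglongrightarrow> c + 0"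
    by (intro tendsto_intros LIMSEQ_inverse_real_of_nat)
  then have "(\<lambda>j. \<integral>w. exp (- (c + inverse (real (Suc j))) * L w) \<partial>M) \<longlonglongrightarrow> (\<integral>w. exp (- c * L w) \<partial>M)"
    using c by (intro laplace_continuous) auto
  from eventually_happens'[OF _ order_tendstoD(1)[OF this u]] obtain a where
    a: "a > c" "u < (\<integral>w. exp (- a * L w) \<partial>M)"
    by (metis inverse_positive_iff_positive less_add_same_cancel1 of_nat_0_less_iff sequentially_bot zero_less_Suc)
  then have "\<forall>\<^sub>F n in sequentially. u < laplace a n"
    using c by (intro order_tendstoD(1)[OF reduced_length_laplace[OF r_lim]]) auto
  moreover have "\<forall>\<^sub>F n in sequentially. laplace a n \<le> moment n"
    using a c by (intro moment_lower) auto
  ultimately show ?thesis by eventually_elim linarith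
qed

text \<open>Any eventual lower bound \<open>K\<close> on \<open>r n * p n\<close> will do: one just
  below \<open>c\<close> in the critical regime, an arbitrarily large one when the product
  diverges.\<close>

lemma moment_eventually_less:
  assumes K: "\<forall>\<^sub>F n in sequentially. K \<le> r n * p n" "K \<ge> 0" and u: "(\<integral>w. exp (- K * L w) \<partial>M) < u"
  shows "\<forall>\<^sub>F n in sequentially. moment n < u"
proof -
  have "(\<lambda>n. K * real k * inverse (r n)) \<longlonglongrightarrow> K * real k * 0"
    by (intro tendsto_mult tendsto_const tendsto_inverse_0_at_top r_lim)
  then have "(\<lambda>n. exp (K * real k / r n) * laplace K n) \<longlonglongrightarrow> exp 0 * (\<integral>w. exp (- K * L w) \<partial>M)"
    using K(2) by (intro tendsto_mult tendsto_exp reduced_length_laplace r_lim) (simp_all add: divide_inverse)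
  then have "\<forall>\<^sub>F n in sequentially. exp (K * real k / r n) * laplace K n < u"
    using u by (intro order_tendstoD(2)) auto
  with moment_upper[OF K] show ?thesis by eventually_elim linarith
qed

lemma moment_tendsto:
  assumes c: "(\<lambda>n. r n * p n) \<longlonglongrightarrow> c" "c > 0"
  shows "(\<lambda>n. moment n) \<longlonglongrightarrow> (\<integral>w. exp (- c * L w) \<partial>M)"
proof (rule order_tendstoI)
  show "\<forall>\<^sub>F n in sequentially. u < moment n" if "u < (\<integral>w. exp (- c * L w) \<partial>M)" for u
    using moment_eventually_gt[OF c(1) _ that] c by simp
next
  fix u assume u: "(\<integral>w. exp (- c * L w) \<partial>M) < u"
  \<comment> \<open>Scaling the correction by \<open>c\<close> keeps these rates nonnegative; for
    \<open>j = 0\<close> the rate is \<open>0\<close>.\<close>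
  have "(\<lambda>j. c - c * inverse (real (Suc j))) \<longlonglongrightarrow> c - c * 0"
    by (intro tendsto_intros LIMSEQ_inverse_real_of_nat)
  moreover have K: "c - c * inverse (real (Suc j)) \<ge> 0" "c - c * inverse (real (Suc j)) < c" for j
    using c by (auto simp: field_simps)
  ultimately have "(\<lambda>j. \<integral>w. exp (- (c - c * inverse (real (Suc j))) * L w) \<partial>M) \<longlonglongrightarrow> (\<integral>w. exp (- c * L w) \<partial>M)"
    by (intro laplace_continuous) auto
  from eventually_happens'[OF _ order_tendstoD(2)[OF this u]] obtain K where
    "0 \<le> K" "K < c" "(\<integral>w. exp (- K * L w) \<partial>M) < u"
    using K by (metis sequentially_bot)
  then show "\<forall>\<^sub>F n in sequentially. moment n < u"
    using order_tendstoD(1)[OF c(1), of K]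
    by (intro moment_eventually_less[of K]) (auto elim: eventually_mono)
qed

end

end

section \<open>The three regimes\<close>

lemma set_pmf_prop_fireproof: "set_pmf (prop_fireproof T p n) \<subseteq> {0..1}"
proof -
  have "card (fireproof_vertices {1..n} E P) \<le> n" for E P
  proof -
    have "fireproof_vertices {1..n} E P \<subseteq> {1..n}" by (auto simp: fireproof_vertices_def)
    from card_mono[OF _ this] show ?thesis by simp
  qed
  then show ?thesis
    by (cases "n = 0") (auto simp: prop_fireproof_def num_fireproof_def field_simps)
qed

theorem proposition1:
  fixes T :: "nat \<Rightarrow> nat set set pmf"
    and p r :: "nat \<Rightarrow> real"
    and M :: "nat \<Rightarrow> 'w measure"
    and L :: "nat \<Rightarrow> 'w \<Rightarrow> real"
  assumes trees: "\<And>n E. n \<ge> 1 \<Longrightarrow> E \<in> set_pmf (T n) \<Longrightarrow> is_tree {1..n} E"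
    and p_range: "\<And>n. n \<ge> 1 \<Longrightarrow> 0 \<le> p n \<and> p n \<le> 1"
    and r_lim: "filterlim r at_top sequentially"
  shows
    "(cut_hypothesis T r 1 (M 1) (L 1) \<and> (\<lambda>n. r n * p n) \<longlonglongrightarrow> 0 \<longrightarrow>
        conv_in_prob (prop_fireproof T p) 1) \<and>
     (cut_hypothesis T r 1 (M 1) (L 1) \<and> filterlim (\<lambda>n. r n * p n) at_top sequentially \<longrightarrow>
        (\<forall>\<epsilon>>0.
           limsup (\<lambda>n. ereal (measure_pmf.prob (num_fireproof {1..n} (T n) (p n))
             {m. real m > \<epsilon> * real n}))
           \<le> ereal (inverse \<epsilon> * measure (M 1) {w \<in> space (M 1). L 1 w = 0})) \<and>
        ((AE w in M 1. L 1 w > 0) \<longrightarrow> conv_in_prob (prop_fireproof T p) 0)) \<and>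
     (\<forall>c>0. (\<forall>k\<ge>1. cut_hypothesis T r k (M k) (L k)) \<and> (\<lambda>n. r n * p n) \<longlonglongrightarrow> c \<longrightarrow>
        (\<exists>D. real_distribution D \<and>
           conv_in_law (prop_fireproof T p) D \<and>
           (\<forall>k\<ge>1. integrable D (\<lambda>x. x ^ k) \<and>
              (\<integral>x. x ^ k \<partial>D) = (\<integral>w. exp (- c * L k w) \<partial>M k)) \<and>
           (\<forall>D'. real_distribution D' \<and>
              (\<forall>k\<ge>1. integrable D' (\<lambda>x. x ^ k) \<and>
                 (\<integral>x. x ^ k \<partial>D') = (\<integral>w. exp (- c * L k w) \<partial>M k)) \<longrightarrow> D' = D) \<and>
           measure D {0} < 1 \<and>
           (\<forall>k\<ge>1. measure D {1} = 1 \<longleftrightarrow> measure (M k) {w \<in> space (M k). L k w = 0} = 1)))"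
proof (intro conjI impI allI; (elim conjE)?)
  let ?E = "\<lambda>n. measure_pmf.expectation (prop_fireproof T p n) (\<lambda>x. x)"
  have E_nonneg: "0 \<le> ?E n" and E_le_1: "?E n \<le> 1" for n
  proof -
    show "0 \<le> ?E n"
      using set_pmf_prop_fireproof[of T p n] by (intro integral_nonneg_AE) (auto simp: AE_measure_pmf_iff)
    have "?E n \<le> measure_pmf.expectation (prop_fireproof T p n) (\<lambda>_. 1)"
      using set_pmf_prop_fireproof[of T p n]
      by (intro integral_mono_AE measure_pmf.integrable_const_bound[where B = 1])
         (auto simp: AE_measure_pmf_iff)
    then show "?E n \<le> 1" by simp
  qed
  {
    assume H: "cut_hypothesis T r 1 (M 1) (L 1)" and rp: "(\<lambda>n. r n * p n) \<longlonglongrightarrow> 0"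
    have "prob_space (M 1)" using H unfolding cut_hypothesis_def by blast
    \<comment> \<open>At rate \<open>0\<close> the Laplace transform is the total mass, so the first
      moment is eventually above every \<open>u < 1\<close>.\<close>
    then have "(\<integral>w. exp (- 0 * L 1 w) \<partial>M 1) = 1" by (simp add: prob_space.prob_space)
    then have "\<forall>\<^sub>F n in sequentially. u < ?E n" if "u < 1" for u
      using moment_eventually_gt[OF H trees p_range r_lim rp] that by simp
    then have "?E \<longlonglongrightarrow> 1"
      using le_less_trans[OF E_le_1] by (intro order_tendstoI) simp_all
    then show "conv_in_prob (prop_fireproof T p) 1"
      by (intro conv_in_prob_1I set_pmf_prop_fireproof)
  next
    assume H: "cut_hypothesis T r 1 (M 1) (L 1)" and rp: "filterlim (\<lambda>n. r n * p n) at_top sequentially"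
    let ?q = "measure (M 1) {w \<in> space (M 1). L 1 w = 0}"
    have less: "\<forall>\<^sub>F n in sequentially. ?E n < u" if u: "?q < u" for u
    proof -
      obtain j where j: "(\<integral>w. exp (- real j * L 1 w) \<partial>M 1) < u"
        using eventually_happens'[OF _ order_tendstoD(2)[OF laplace_at_top[OF H] u]] by auto
      have "\<forall>\<^sub>F n in sequentially. real j \<le> r n * p n"
        using rp by (simp add: filterlim_at_top)
      from moment_eventually_less[OF H trees p_range r_lim this _ j] show ?thesis by simp
    qed
    {
      fix \<epsilon> :: real assume \<epsilon>: "\<epsilon> > 0"
      show "limsup (\<lambda>n. ereal (measure_pmf.prob (num_fireproof {1..n} (T n) (p n)) {m. real m > \<epsilon> * real n}))
          \<le> ereal (inverse \<epsilon> * ?q)"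
      proof (rule ereal_le_epsilon2)
        fix e :: real assume e: "e > 0"
        \<comment> \<open>The slack \<open>e * \<epsilon>\<close> becomes \<open>e\<close> after the
          division by \<open>\<epsilon>\<close> in Markov's inequality.\<close>
        have "\<forall>\<^sub>F n in sequentially. ?E n < ?q + e * \<epsilon>"
          using e \<epsilon> by (intro less) simp
        then have "\<forall>\<^sub>F n in sequentially.
            ereal (measure_pmf.prob (num_fireproof {1..n} (T n) (p n)) {m. real m > \<epsilon> * real n})
            \<le> ereal (inverse \<epsilon> * ?q + e)"
          using eventually_ge_at_top[of 1]
        proof eventually_elim
          case (elim n)
          have "measure_pmf.prob (num_fireproof {1..n} (T n) (p n)) {m. real m > \<epsilon> * real n} =
              measure_pmf.prob (prop_fireproof T p n) {x. x > \<epsilon>}"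
            using elim by (simp add: prop_fireproof_def vimage_def field_simps)
          also have "\<dots> \<le> ?E n / \<epsilon>"
            by (rule prob_gt_le_expectation[OF set_pmf_prop_fireproof \<epsilon>])
          also have "\<dots> \<le> (?q + e * \<epsilon>) / \<epsilon>"
            using elim \<epsilon> by (intro divide_right_mono) auto
          also have "\<dots> = inverse \<epsilon> * ?q + e"
            using \<epsilon> by (simp add: field_simps)
          finally show ?case by simp
        qed
        then show "limsup (\<lambda>n. ereal (measure_pmf.prob (num_fireproof {1..n} (T n) (p n)) {m. real m > \<epsilon> * real n}))
            \<le> ereal (inverse \<epsilon> * ?q) + ereal e"
          by (intro Limsup_bounded) simp
      qed
    next
      assume pos: "AE w in M 1. L 1 w > 0"
      have "?q = measure (M 1) {}"
        using pos L_measurable[OF H] by (intro measure_eq_AE) auto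
      then have "?E \<longlonglongrightarrow> 0"
        using less less_le_trans[OF _ E_nonneg]
        by (intro order_tendstoI) simp_all
      then show "conv_in_prob (prop_fireproof T p) 0"
        by (intro conv_in_prob_0I set_pmf_prop_fireproof)
    }
  next
    fix c :: real
    assume c: "c > 0" and H: "\<forall>k\<ge>1. cut_hypothesis T r k (M k) (L k)"
      and rp: "(\<lambda>n. r n * p n) \<longlonglongrightarrow> c"
    define m where "m k = (\<integral>w. exp (- c * L k w) \<partial>M k)" for k
    have hyp: "cut_hypothesis T r k (M k) (L k)" if "k \<ge> 1" for k
      using H that by blast
    have moments: "(\<lambda>n. \<integral>x. x ^ k \<partial>prop_fireproof T p n) \<longlonglongrightarrow> m k" if "k \<ge> 1" for k
      unfolding m_def by (rule moment_tendsto[OF hyp[OF that] trees p_range r_lim rp c])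
    obtain D where D: "real_distribution D" and conv: "conv_in_law (prop_fireproof T p) D"
      and unit: "AE x in D. x \<in> {0..1}" and mD: "\<And>k. k \<ge> 1 \<Longrightarrow> (\<integral>x. x ^ k \<partial>D) = m k"
      using conv_moments_unit_interval[of "prop_fireproof T p" m, OF set_pmf_prop_fireproof moments] by metis
    interpret D: real_distribution D by fact
    have int: "integrable D (\<lambda>x. x ^ k)" for k
    proof (rule D.integrable_const_bound)
      show "AE x in D. norm (x ^ k) \<le> 1"
        using unit by eventually_elim (simp add: power_le_one)
    qed simp
    have pow_le: "AE x in D. x ^ k \<le> 1" for k
      using unit by eventually_elim (simp add: power_le_one)
    have m_le: "m k \<le> 1" if "k \<ge> 1" for k
      using integral_mono_AE[OF int _ pow_le[of k]] mD[OF that] D.prob_space by simp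
    \<comment> \<open>On \<open>[0, 1]\<close> a power with \<open>k \<ge> 1\<close> equals
      \<open>1\<close> only at \<open>1\<close>, so a single moment detects the point mass at
      \<open>1\<close>; \<open>laplace_eq_1_iff\<close> then translates it to
      \<open>L k\<close>.\<close>
    have eq_1: "measure D {1} = 1 \<longleftrightarrow> m k = 1" if k: "k \<ge> 1" for k
    proof -
      have "m k = 1 \<longleftrightarrow> (\<integral>x. 1 - x ^ k \<partial>D) = 0"
        using int[of k] mD[OF k] D.prob_space by auto
      also have "\<dots> \<longleftrightarrow> (AE x in D. 1 - x ^ k = 0)"
        using int[of k] pow_le[of k] by (intro integral_nonneg_eq_0_iff_AE) auto
      also have "\<dots> \<longleftrightarrow> (AE x in D. x \<in> {1})"
      proof (rule eventually_subst)
        show "AE x in D. (1 - x ^ k = 0) = (x \<in> {1})"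
          using unit by eventually_elim (use k power_eq_iff_eq_base[of k _ 1] in auto)
      qed
      also have "\<dots> \<longleftrightarrow> measure D {1} = 1"
        by (subst D.prob_eq_1) auto
      finally show ?thesis by simp
    qed
    have "measure D {0} \<noteq> 1"
    proof
      assume "measure D {0} = 1"
      then have "AE x in D. x = 0" by (subst (asm) D.prob_eq_1) auto
      then have "m 1 = 0" using mD[of 1] integral_eq_zero_AE[of "\<lambda>x. x" D] by simp
      then show False using laplace_pos[OF hyp[of 1], of c] c by (simp add: m_def)
    qed
    then have "measure D {0} < 1"
      using D.prob_le_1[of "{0}"] by linarith
    moreover have "measure D {1} = 1 \<longleftrightarrow> measure (M k) {w \<in> space (M k). L k w = 0} = 1" if "k \<ge> 1" for k
      unfolding eq_1[OF that] m_def by (rule laplace_eq_1_iff[OF hyp[OF that] c])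
    moreover have "D' = D"
      if "real_distribution D'"
        and "\<And>k. k \<ge> 1 \<Longrightarrow> integrable D' (\<lambda>x. x ^ k) \<and> (\<integral>x. x ^ k \<partial>D') = m k" for D'
      using that int mD m_le by (intro moments_determine_distribution[OF D, of D' m]) auto
    ultimately show "\<exists>D. real_distribution D \<and>
           conv_in_law (prop_fireproof T p) D \<and>
           (\<forall>k\<ge>1. integrable D (\<lambda>x. x ^ k) \<and>
              (\<integral>x. x ^ k \<partial>D) = (\<integral>w. exp (- c * L k w) \<partial>M k)) \<and>
           (\<forall>D'. real_distribution D' \<and>
              (\<forall>k\<ge>1. integrable D' (\<lambda>x. x ^ k) \<and>
                 (\<integral>x. x ^ k \<partial>D') = (\<integral>w. exp (- c * L k w) \<partial>M k)) \<longrightarrow> D' = D) \<and>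
           measure D {0} < 1 \<and>
           (\<forall>k\<ge>1. measure D {1} = 1 \<longleftrightarrow> measure (M k) {w \<in> space (M k). L k w = 0} = 1)"
      using D conv int mD unfolding m_def by (intro exI[of _ D]) blast
  }
qed

end
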